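(* Let $\alpha^+,\lambda^+,\alpha^-,\lambda^-\in(0,\infty)$ and $\beta^+,\beta^-\in(0,1)$, and let $g$ be the (continuous) density of the tempered stable distribution $\eta=\mathrm{TS}(\alpha^+,\beta^+,\lambda^+;\alpha^-,\beta^-,\lambda^-)$. Then $$g(x)\sim C\,\frac{e^{-\lambda^+x}}{x^{1+\beta^+}}\quad\text{as }x\to\infty,$$ where the constant $C>0$ is given by $$C=\alpha^+\exp\Big(-\alpha^+\Gamma(-\beta^+)(\lambda^+)^{\beta^+}+\alpha^-\Gamma(-\beta^-)\big[(\lambda^++\lambda^-)^{\beta^-}-(\lambda^-)^{\beta^-}\big]\Big).$$
   Context: For $\alpha^+,\lambda^+,\alpha^-,\lambda^-\in(0,\infty)$ and $\beta^+,\beta^-\in[0,1)$, the tempered stable distribution $\mathrm{TS}(\alpha^+,\beta^+,\lambda^+;\alpha^-,\beta^-,\lambda^-)$ is the infinitely divisible distribution on $\mathbb{R}$ with characteristic function $\varphi(z)=\exp\big(\int_{\mathbb{R}}(e^{izx}-1)F(dx)\big)$, $z\in\mathbb{R}$, where $$F(dx)=\Big(\frac{\alpha^+}{x^{1+\beta^+}}e^{-\lambda^+x}\mathbf{1}_{(0,\infty)}(x)+\frac{\alpha^-}{|x|^{1+\beta^-}}e^{-\lambda^-|x|}\mathbf{1}_{(-\infty,0)}(x)\Big)dx.$$ For $\beta^+,\beta^-\in(0,1)$ it is absolutely continuous with a density $g$ of class $C^\infty(\mathbb{R})$. The notation $a(x)\sim b(x)$ means that $a(x)/b(x)\to1$ in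 the indicated limit. $\Gamma:\mathbb{R}\setminus\{0,-1,-2,\ldots\}\to\mathbb{R}$ is the Gamma function. *)

theory Defs
  imports "HOL-Probability.Probability" "HOL-Library.Landau_Symbols"
begin

definition ts_levy_density ::
  "real \<Rightarrow> real \<Rightarrow> real \<Rightarrow> real \<Rightarrow> real \<Rightarrow> real \<Rightarrow> real \<Rightarrow> real" where
  "ts_levy_density \<alpha>p \<beta>p lp \<alpha>m \<beta>m lm x =
     \<alpha>p / (x powr (1 + \<beta>p)) * exp (- lp * x) * indicator {0<..} x
   + \<alpha>m / (\<bar>x\<bar> powr (1 + \<beta>m)) * exp (- lm * \<bar>x\<bar>) * indicator {..<0} x"

definition ts_levy_measure ::
  "real \<Rightarrow> real \<Rightarrow> real \<Rightarrow> real \<Rightarrow> real \<Rightarrow> real \<Rightarrow> real measure" where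
  "ts_levy_measure \<alpha>p \<beta>p lp \<alpha>m \<beta>m lm =
     density lborel (\<lambda>x. ennreal (ts_levy_density \<alpha>p \<beta>p lp \<alpha>m \<beta>m lm x))"

(* lp, lm stand for lambda^+, lambda^-. "M is the distribution TS(\<alpha>p, \<beta>p, lp; \<alpha>m, \<beta>m, lm)". The characteristic function
   determines M uniquely (Levy_uniqueness); infinite divisibility is a consequence of its
   form and is not required separately. Intended for \<alpha>p, lp, \<alpha>m, lm > 0 and \<beta>p, \<beta>m in [0,1),
   where the integrand is integrable with respect to the (infinite) Levy measure. *)
definition tempered_stable ::
  "real \<Rightarrow> real \<Rightarrow> real \<Rightarrow> real \<Rightarrow> real \<Rightarrow> real \<Rightarrow> real measure \<Rightarrow> bool" where
  "tempered_stable \<alpha>p \<beta>p lp \<alpha>m \<beta>m lm M \<longleftrightarrow>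
     real_distribution M \<and>
     (\<forall>z. char M z = exp (CLINT x | ts_levy_measure \<alpha>p \<beta>p lp \<alpha>m \<beta>m lm. iexp (z * x) - 1))"

end

theory Submission
  imports Defs "HOL-Real_Asymp.Real_Asymp"
begin

text \<open>
  Let \<open>k x = x * f x\<close> with \<open>f\<close> the Levy density; it is integrable because the exponents are
  below \<open>1\<close>. Differentiating the characteristic function \<open>exp \<psi>\<close> shows that \<open>x * g x\<close> and the
  convolution of \<open>g\<close> and \<open>k\<close> have the same Fourier transform, so they agree almost everywhere.
  This identity first bounds the exponential moments of order \<open>s < lp\<close>, then turns into the
  differential equation \<open>m' = m * \<kappa>\<close> for the moment generating function, which gives
  \<open>m = exp \<Lambda>\<close> on \<open>[0, lp)\<close> and, by letting \<open>s\<close> tend to \<open>lp\<close>, the total mass of the tilted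
  density \<open>h x = exp (lp * x) * g x\<close>. Tilting removes the exponential factor from the positive part
  of \<open>k\<close>, so that \<open>h\<close> solves a renewal type equation with kernel \<open>y powr (- \<beta>p)\<close>. Bootstrapping
  this equation yields in turn that \<open>h\<close> is bounded, \<open>O(1/x)\<close> and \<open>O(x powr (- 1 - \<beta>p))\<close>; then the
  main contribution comes from \<open>y\<close> close to \<open>x\<close> and equals \<open>x powr (- \<beta>p)\<close> times the mass
  of \<open>h\<close>.
\<close>

section \<open>Fourier transforms and convolutions on the line\<close>

text \<open>A nonempty open set is not Lebesgue null, so a continuous function cannot exceed
  \<open>c\<close> on a null set only. This turns the almost everywhere consequences of the
  convolution equation into pointwise bounds.\<close>

lemma AE_open_imp_le:
  fixes u :: "real \<Rightarrow> real"
  assumes S: "open S" and cont: "continuous_on S u"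
    and ae: "AE x in lborel. x \<in> S \<longrightarrow> u x \<le> c" and x: "x \<in> S"
  shows "u x \<le> c"
proof (rule ccontr)
  assume "\<not> u x \<le> c"
  define T where "T = S \<inter> u -` {c<..}"
  have "open T"
    unfolding T_def using cont S by (intro continuous_open_preimage) auto
  moreover have "x \<in> T"
    using x \<open>\<not> u x \<le> c\<close> by (simp add: T_def)
  moreover obtain N where "N \<in> null_sets lborel" "{x. \<not> (x \<in> S \<longrightarrow> u x \<le> c)} \<subseteq> N"
    using ae by (auto elim!: AE_E simp: null_sets_def)
  then have "negligible N" "T \<subseteq> N"
    by (auto simp: negligible_iff_null_sets T_def null_sets_completionI)
  ultimately show False
    using open_not_negligible[of T] negligible_subset by blast
qed

text \<open>Fubini for \<open>p (x - y) * q y\<close> together with translation invariance. The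
  values lie in a general field because both real densities and complex Fourier integrands are
  convolved later.\<close>

lemma convolution_L1:
  fixes p q :: "real \<Rightarrow> 'a::{real_normed_field, second_countable_topology, banach}"
  assumes p: "integrable lborel p" and q: "integrable lborel q"
  shows AE_integrable_convolution: "AE x in lborel. integrable lborel (\<lambda>y. p (x - y) * q y)"
    and integrable_convolution: "integrable lborel (\<lambda>x. \<integral>y. p (x - y) * q y \<partial>lborel)"
    and integral_convolution:
      "(\<integral>x. (\<integral>y. p (x - y) * q y \<partial>lborel) \<partial>lborel) = (\<integral>x. p x \<partial>lborel) * (\<integral>x. q x \<partial>lborel)"
proof -
  have [measurable]: "p \<in> borel_measurable borel" "q \<in> borel_measurable borel"
    using p q by auto
  have shift: "integrable lborel (\<lambda>x. f (x - y))" "(\<integral>x. f (x - y) \<partial>lborel) = (\<integral>x. f x \<partial>lborel)"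
    if "integrable lborel f" for f :: "real \<Rightarrow> 'b::{second_countable_topology, banach}" and y
    using lborel_integrable_real_affine[OF that, of 1 "-y"] lborel_integral_real_affine[of 1 f "-y"]
    by auto
  define F where "F = (\<lambda>(y, x). p (x - y) * q y)"
  have F: "integrable (lborel \<Otimes>\<^sub>M lborel) F"
  proof (rule lborel_pair.Fubini_integrable)
    show "F \<in> borel_measurable (lborel \<Otimes>\<^sub>M lborel)"
      unfolding F_def by measurable
    have "(\<integral>x. norm (F (y, x)) \<partial>lborel) = (\<integral>x. norm (p x) \<partial>lborel) * norm (q y)" for y
      using shift(2)[OF integrable_norm[OF p], of y] by (simp add: F_def norm_mult)
    then show "integrable lborel (\<lambda>y. \<integral>x. norm (F (y, x)) \<partial>lborel)"
      using q by simp
    show "AE y in lborel. integrable lborel (\<lambda>x. F (y, x))"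
      using shift(1)[OF p] by (simp add: F_def)
  qed
  then have F': "integrable (lborel \<Otimes>\<^sub>M lborel) (\<lambda>(x, y). F (y, x))"
    by (rule lborel_pair.integrable_product_swap)
  show "AE x in lborel. integrable lborel (\<lambda>y. p (x - y) * q y)"
    using lborel_pair.AE_integrable_fst'[OF F'] by (simp add: F_def)
  show "integrable lborel (\<lambda>x. \<integral>y. p (x - y) * q y \<partial>lborel)"
    using lborel_pair.integrable_fst'[OF F'] by (simp add: F_def)
  have "(\<integral>x. (\<integral>y. F (y, x) \<partial>lborel) \<partial>lborel) = (\<integral>y. (\<integral>x. F (y, x) \<partial>lborel) \<partial>lborel)"
    using lborel_pair.Fubini_integral[of "\<lambda>y x. F (y, x)"] F by simp
  then show "(\<integral>x. (\<integral>y. p (x - y) * q y \<partial>lborel) \<partial>lborel) = (\<integral>x. p x \<partial>lborel) * (\<integral>x. q x \<partial>lborel)"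
    by (simp add: F_def shift(2)[OF p])
qed

text \<open>Levy uniqueness concerns probability measures. Hence \<open>w\<close> is split into its
  positive part \<open>d 1\<close> and negative part \<open>d (-1)\<close>, which have equal Fourier
  transforms and, at frequency 0, equal mass \<open>c\<close>; dividing by \<open>c\<close> gives
  two probability densities.\<close>

lemma fourier_L1_unique:
  fixes w :: "real \<Rightarrow> real"
  assumes w: "integrable lborel w"
    and zero: "\<And>u. (CLBINT x. iexp (u * x) * of_real (w x)) = 0"
  shows "AE x in lborel. w x = 0"
proof -
  have wm[measurable]: "w \<in> borel_measurable borel" using w by auto
  define c where "c = (\<integral>x. max 0 (w x) \<partial>lborel)"
  define d where "d s x = max 0 (s * w x)" for s x :: real
  have dint: "integrable lborel (d s)" for s
    unfolding d_def using w by auto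
  have dm[measurable]: "d s \<in> borel_measurable borel" for s
    unfolding d_def by measurable
  have d0: "d s x \<ge> 0" for s x by (simp add: d_def)
  have w_eq: "w x = d 1 x - d (-1) x" for x by (simp add: d_def)
  have four: "(CLBINT x. iexp (u * x) * of_real (d 1 x)) = (CLBINT x. iexp (u * x) * of_real (d (-1) x))" for u
  proof -
    have I: "complex_integrable lborel (\<lambda>x. iexp (u * x) * of_real (d s x))" for s
      by (rule Bochner_Integration.integrable_bound[OF dint[of s]]) (auto simp: norm_mult)
    have "(CLBINT x. iexp (u * x) * of_real (w x)) =
      (CLBINT x. iexp (u * x) * of_real (d 1 x)) - (CLBINT x. iexp (u * x) * of_real (d (-1) x))"
      by (subst Bochner_Integration.integral_diff[symmetric, OF I I]) (simp add: w_eq algebra_simps)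
    then show ?thesis using zero[of u] by simp
  qed
  have c1: "(\<integral>x. d 1 x \<partial>lborel) = c" by (simp add: c_def d_def)
  have c2: "(\<integral>x. d (-1) x \<partial>lborel) = c"
    using four[of 0] c1 by simp
  have "AE x in lborel. d 1 x = d (-1) x"
  proof (cases "c = 0")
    case True
    then have "AE x in lborel. d s x = 0" if "s = 1 \<or> s = -1" for s
      using that c1 c2 integral_nonneg_eq_0_iff_AE[OF dint[of s]] d0 by auto
    from this[of 1] this[of "-1"] show ?thesis by auto
  next
    case False
    moreover have "c \<ge> 0" unfolding c_def by (intro integral_nonneg_AE) auto
    ultimately have cpos: "c > 0" by simp
    define M where "M s = density lborel (\<lambda>x. ennreal (d s x / c))" for s
    have M: "real_distribution (M s)" if "s = 1 \<or> s = -1" for s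
    proof -
      have "emeasure (M s) (space (M s)) = ennreal (\<integral>x. d s x / c \<partial>lborel)"
        unfolding M_def using dint cpos d0
        by (subst nn_integral_eq_integral[symmetric]) (auto simp: emeasure_density)
      also have "\<dots> = 1" using that c1 c2 cpos by auto
      finally have "prob_space (M s)" by (rule prob_spaceI)
      then show ?thesis
        by (simp add: real_distribution_def real_distribution_axioms_def M_def)
    qed
    have chM: "char (M s) u = (CLBINT x. iexp (u * x) * of_real (d s x)) / c" for s u
      unfolding char_def M_def using d0 cpos
      by (subst integral_density) (auto simp: scaleR_conv_of_real mult_ac divide_inverse)
    have "M 1 = M (-1)"
      by (rule Levy_uniqueness[OF M M]) (simp_all add: fun_eq_iff chM four del: of_real_mult)
    then have "AE x in lborel. ennreal (d 1 x / c) = ennreal (d (-1) x / c)"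
      unfolding M_def by (subst (asm) sigma_finite_measure.density_unique_iff[OF sigma_finite_lborel]) auto
    then show ?thesis
      by (rule AE_mp) (use cpos d0 in auto)
  qed
  then show ?thesis by (rule AE_mp) (auto simp: w_eq)
qed

lemma has_bochner_integral_Gamma:
  fixes a l :: real
  assumes a: "a > 0" and l: "l > 0"
  shows "has_bochner_integral lborel (\<lambda>x. indicator {0<..} x * (x powr (a - 1) * exp (- (l * x)))) (Gamma a / l powr a)"
proof -
  have "has_bochner_integral lborel (\<lambda>t. indicator {0..} t * t powr (a - 1) / exp t) (Gamma a)"
    using Gamma_conv_nn_integral_real[OF a] Gamma_real_pos[OF a]
    by (intro has_bochner_integral_nn_integral) auto
  then have "has_bochner_integral lborel (\<lambda>t. indicator {0<..} t * (t powr (a - 1) * exp (- t))) (Gamma a)"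
    by (rule has_bochner_integral_cong[THEN iffD1, rotated -1])
       (auto simp: indicator_def exp_minus divide_inverse)
  then have "has_bochner_integral lborel (\<lambda>x. indicator {0<..} (l * x) * ((l * x) powr (a - 1) * exp (- (l * x)))) (Gamma a / l)"
    using lborel_has_bochner_integral_real_affine_iff[of l "\<lambda>t. indicator {0<..} t * (t powr (a - 1) * exp (- t))" "Gamma a" 0] l
    by (simp add: divide_inverse mult.commute)
  then have *: "has_bochner_integral lborel (\<lambda>x. indicator {0<..} (l * x) * ((l * x) powr (a - 1) * exp (- (l * x))) / l powr (a - 1)) (Gamma a / l / l powr (a - 1))"
    by (rule has_bochner_integral_divide_zero)
  have eq: "Gamma a / l / l powr (a - 1) = Gamma a / l powr a"
    using l by (simp add: powr_diff)
  have "indicator {0<..} (l * x) * ((l * x) powr (a - 1) * exp (- (l * x))) / l powr (a - 1)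
     = indicator {0<..} x * (x powr (a - 1) * exp (- (l * x)))" for x
    using l by (auto simp: indicator_def powr_mult zero_less_mult_iff)
  then show ?thesis using * unfolding eq by (simp only:)
qed

text \<open>Replaces differentiation under the integral sign: a Taylor remainder with an integrable
  quadratic bound integrates to exactly this hypothesis.\<close>

lemma has_vector_derivative_quadratic:
  fixes F :: "real \<Rightarrow> 'a::real_normed_vector"
  assumes "s \<in> S" and bnd: "\<And>t. t \<in> S \<Longrightarrow> norm (F t - F s - (t - s) *\<^sub>R D) \<le> C * (t - s)\<^sup>2"
  shows "(F has_vector_derivative D) (at s within S)"
  unfolding has_vector_derivative_def has_derivative_within_alt
proof (intro conjI allI impI bounded_linear_scaleR_left)
  fix e :: real assume e: "0 < e"
  define d where "d = e / (\<bar>C\<bar> + 1)"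
  have "norm (F t - F s - (t - s) *\<^sub>R D) \<le> e * norm (t - s)" if "t \<in> S" "norm (t - s) < d" for t
  proof -
    have "C * (t - s)\<^sup>2 \<le> (\<bar>C\<bar> + 1) * \<bar>t - s\<bar> * \<bar>t - s\<bar>"
      by (simp add: power2_eq_square mult.assoc abs_mult_self_eq mult_right_mono)
    also have "\<dots> \<le> e * \<bar>t - s\<bar>"
      using that e by (intro mult_right_mono) (auto simp: d_def field_simps)
    finally show ?thesis using bnd[OF that(1)] by simp
  qed
  moreover have "d > 0" using e by (simp add: d_def)
  ultimately show "\<exists>d>0. \<forall>t\<in>S. norm (t - s) < d \<longrightarrow> norm (F t - F s - (t - s) *\<^sub>R D) \<le> e * norm (t - s)"
    by blast
qed

section \<open>Tails of solutions of a renewal type equation\<close>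

lemma has_bochner_integral_powr_from_0:
  fixes \<beta> d :: real
  assumes \<beta>: "\<beta> < 1" and d: "d \<ge> 0"
  shows "has_bochner_integral lborel (\<lambda>y. indicator {0<..d} y * y powr - \<beta>) (d powr (1 - \<beta>) / (1 - \<beta>))"
proof -
  have "((\<lambda>y. y powr - \<beta>) has_integral (d powr (- \<beta> + 1) / (- \<beta> + 1))) {0..d}"
    using has_integral_powr_from_0[of "- \<beta>" d] \<beta> d by simp
  from nn_integral_has_integral_lebesgue[OF _ this]
  have "(\<integral>\<^sup>+y. ennreal (indicator {0..d} y * y powr - \<beta>) \<partial>lborel) = ennreal (d powr (1 - \<beta>) / (1 - \<beta>))"
    by simp
  then have "has_bochner_integral lborel (\<lambda>y. indicator {0..d} y * y powr - \<beta>) (d powr (1 - \<beta>) / (1 - \<beta>))"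
    using \<beta> by (intro has_bochner_integral_nn_integral) auto
  then show ?thesis
    by (rule has_bochner_integral_cong[THEN iffD1, rotated -1]) (auto simp: indicator_def)
qed

text \<open>The integrability clause in \<open>renewal\<close> matters because a Bochner integral
  defaults to 0; without it \<open>P\<close> could not be bounded from below by one of its
  parts.\<close>

locale renewal_tail =
  fixes h :: "real \<Rightarrow> real" and a b c \<beta> \<gamma> K :: real and P N :: "real \<Rightarrow> real"
  assumes h_int: "integrable lborel h" and h_cont: "continuous_on UNIV h" and h_nonneg: "\<And>x. h x \<ge> 0"
    and a: "a > 0" and b: "b > 0" and c: "c > 0"
    and \<beta>: "0 < \<beta>" "\<beta> < 1" and \<gamma>: "0 < \<gamma>" "\<gamma> < 1"
  defines "K \<equiv> \<integral>x. h x \<partial>lborel"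
    and "P \<equiv> \<lambda>x. \<integral>y. indicator {0<..} y * (h (x - y) * y powr - \<beta>) \<partial>lborel"
    and "N \<equiv> \<lambda>x. \<integral>y. indicator {0<..} y * (h (x + y) * (y powr - \<gamma> * exp (- (c * y)))) \<partial>lborel"
  assumes renewal: "AE x in lborel. x > 0 \<longrightarrow>
      integrable lborel (\<lambda>y. indicator {0<..} y * (h (x - y) * y powr - \<beta>)) \<and> x * h x = a * P x - b * N x"
begin

lemma h_meas[measurable]: "h \<in> borel_measurable borel"
  using h_int by auto

lemma K_nonneg: "K \<ge> 0"
  unfolding K_def using h_nonneg by simp

lemma shift_int: "integrable lborel (\<lambda>y. h (x - y))" "(\<integral>y. h (x - y) \<partial>lborel) = K"
  using lborel_integrable_real_affine[OF h_int, of "-1" x] lborel_integral_real_affine[of "-1" h x]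
  by (auto simp: K_def)

lemma N_nonneg: "N x \<ge> 0"
  unfolding N_def using h_nonneg by (intro integral_nonneg_AE) auto

lemma N_le:
  assumes M: "\<And>t. t \<ge> x \<Longrightarrow> h t \<le> M"
  shows "N x \<le> M * (Gamma (1 - \<gamma>) / c powr (1 - \<gamma>))"
proof -
  have M0: "M \<ge> 0" using M[of x] h_nonneg[of x] by simp
  have I: "has_bochner_integral lborel (\<lambda>y. M * (indicator {0<..} y * (y powr (1 - \<gamma> - 1) * exp (- (c * y))))) (M * (Gamma (1 - \<gamma>) / c powr (1 - \<gamma>)))"
    using \<gamma> c by (intro has_bochner_integral_mult_right has_bochner_integral_Gamma) auto
  have "N x \<le> (\<integral>y. M * (indicator {0<..} y * (y powr (1 - \<gamma> - 1) * exp (- (c * y)))) \<partial>lborel)"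
    unfolding N_def using M M0 h_nonneg
    by (intro integral_mono' integrable.intros[OF I])
       (auto simp: indicator_def intro!: mult_right_mono)
  then show ?thesis using has_bochner_integral_integral_eq[OF I] by simp
qed

text \<open>The part of \<open>P x\<close> that samples \<open>h\<close> below
  \<open>x - d\<close>.\<close>

definition far :: "real \<Rightarrow> real \<Rightarrow> real" where
  "far d x = (\<integral>y. indicator {d<..} y * (h (x - y) * y powr - \<beta>) \<partial>lborel)"

text \<open>For \<open>y \<le> d\<close> the values of \<open>h\<close> are at most \<open>M\<close>
  and the kernel has a finite integral; for \<open>y > d\<close> the kernel is at most
  \<open>d powr - \<beta>\<close> and \<open>h\<close> has mass \<open>K\<close>. Every bootstrap
  step is a choice of \<open>d\<close> in this trade-off.\<close>

lemma P_le_split: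
  assumes d: "d > 0" and M: "\<And>t. x - d \<le> t \<Longrightarrow> t \<le> x \<Longrightarrow> h t \<le> M"
  shows "P x \<le> M * (d powr (1 - \<beta>) / (1 - \<beta>)) + far d x"
    and integrable_far: "integrable lborel (\<lambda>y. indicator {d<..} y * (h (x - y) * y powr - \<beta>))"
    and far_le: "far d x \<le> d powr - \<beta> * K"
proof -
  have M0: "M \<ge> 0" using M[of x] h_nonneg[of x] d by simp
  have I: "has_bochner_integral lborel (\<lambda>y. M * (indicator {0<..d} y * y powr - \<beta>)) (M * (d powr (1 - \<beta>) / (1 - \<beta>)))"
    using d \<beta> by (intro has_bochner_integral_mult_right has_bochner_integral_powr_from_0) auto
  have le: "indicator {d<..} y * (h (x - y) * y powr - \<beta>) \<le> d powr - \<beta> * h (x - y)" for y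
    using h_nonneg[of "x - y"] d \<beta>
    by (auto simp: indicator_def mult.commute[of "h _"] intro!: mult_right_mono powr_mono2')
  have J: "integrable lborel (\<lambda>y. d powr - \<beta> * h (x - y))"
    using shift_int by simp
  show far: "integrable lborel (\<lambda>y. indicator {d<..} y * (h (x - y) * y powr - \<beta>))"
    using h_nonneg le by (intro Bochner_Integration.integrable_bound[OF J]) auto
  have "far d x \<le> (\<integral>y. d powr - \<beta> * h (x - y) \<partial>lborel)"
    unfolding far_def using le by (intro integral_mono far J) auto
  then show "far d x \<le> d powr - \<beta> * K" by (simp add: shift_int)
  have "P x \<le> (\<integral>y. M * (indicator {0<..d} y * y powr - \<beta>) + indicator {d<..} y * (h (x - y) * y powr - \<beta>) \<partial>lborel)"
    unfolding P_def using M M0 h_nonneg d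
    by (intro integral_mono' Bochner_Integration.integrable_add integrable.intros[OF I] far)
       (auto simp: indicator_def intro!: mult_right_mono)
  then show "P x \<le> M * (d powr (1 - \<beta>) / (1 - \<beta>)) + far d x"
    using has_bochner_integral_integral_eq[OF I] far integrable.intros[OF I] by (simp add: far_def)
qed

lemma P_le:
  assumes "d > 0" and "\<And>t. x - d \<le> t \<Longrightarrow> t \<le> x \<Longrightarrow> h t \<le> M"
  shows "P x \<le> M * (d powr (1 - \<beta>) / (1 - \<beta>)) + d powr - \<beta> * K"
  using P_le_split(1)[of d x M, OF assms] far_le[of d x M, OF assms] by simp

section \<open>Successive upper bounds for \<open>h\<close>\<close>

lemma AE_h_le: "AE x in lborel. x > 0 \<longrightarrow> x * h x \<le> a * P x"
  using renewal
proof (rule AE_mp, intro AE_I2 impI)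
  fix x assume "x > 0 \<longrightarrow> integrable lborel (\<lambda>y. indicator {0<..} y * (h (x - y) * y powr - \<beta>)) \<and> x * h x = a * P x - b * N x" "x > 0"
  then show "x * h x \<le> a * P x" using N_nonneg[of x] b by simp
qed

text \<open>
  For large \<open>x\<close> the equation bounds \<open>h x\<close> by half of the maximum of \<open>h\<close> on \<open>[1, x]\<close> plus a constant.
\<close>

lemma h_bounded: "\<exists>B\<ge>0. \<forall>x\<ge>1. h x \<le> B"
proof -
  \<comment> \<open>For \<open>t > X0\<close>, the bound 2 keeps the window
    \<open>[t - 1, t]\<close> inside \<open>[1, x]\<close> and absorbs the factor 2 in front of
    \<open>a * K / 2\<close>; the other bound makes the coefficient of \<open>h m\<close> at most
    \<open>t / 2\<close>.\<close>
  define X0 where "X0 = max 2 (2 * a / (1 - \<beta>))"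
  have X0: "X0 \<ge> 2" "2 * a / (1 - \<beta>) \<le> X0" by (auto simp: X0_def)
  have attain: "\<exists>m\<in>{1..X}. \<forall>x\<in>{1..X}. h x \<le> h m" if "X \<ge> 1" for X
    using that continuous_on_subset[OF h_cont] by (intro continuous_attains_sup) auto
  obtain m0 where m0: "\<And>x. 1 \<le> x \<Longrightarrow> x \<le> X0 \<Longrightarrow> h x \<le> h m0"
    using attain[of X0] X0 by fastforce
  define B where "B = max (h m0) (a * K)"
  have "h x \<le> B" if x: "x > X0" for x
  proof -
    obtain m where m: "1 \<le> m" "m \<le> x" "\<And>t. 1 \<le> t \<Longrightarrow> t \<le> x \<Longrightarrow> h t \<le> h m"
      using attain[of x] X0 x by auto
    have ae: "AE t in lborel. t \<in> {X0<..<x} \<longrightarrow> h t \<le> h m / 2 + a * K / 2"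
      using AE_h_le
    proof (rule AE_mp, intro AE_I2 impI)
      fix t assume t: "t > 0 \<longrightarrow> t * h t \<le> a * P t" "t \<in> {X0<..<x}"
      then have t2: "t > 2" "t > 2 * a / (1 - \<beta>)" using X0 by auto
      have "P t \<le> h m / (1 - \<beta>) + K"
        using P_le[of 1 t "h m"] t t2 m(3) by auto
      then have "t * h t \<le> a * (h m / (1 - \<beta>) + K)"
        using t t2 a by (smt (verit) mult_left_mono)
      also have "\<dots> = (2 * a / (1 - \<beta>)) * (h m / 2) + 2 * (a * K / 2)"
        by (simp add: algebra_simps)
      also have "\<dots> \<le> t * (h m / 2) + t * (a * K / 2)"
        using t2 h_nonneg[of m] K_nonneg a by (intro add_mono mult_right_mono) auto
      finally have "t * h t \<le> t * (h m / 2 + a * K / 2)" by (simp add: algebra_simps)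
      then show "h t \<le> h m / 2 + a * K / 2" using t2 by simp
    qed
    have on: "h t \<le> h m / 2 + a * K / 2" if "t \<in> {X0<..<x}" for t
      by (rule AE_open_imp_le[OF _ _ ae that]) (auto intro: continuous_on_subset[OF h_cont])
    \<comment> \<open>The maximiser \<open>m\<close> may be the endpoint \<open>x\<close>, so the
      bound has to reach the closed interval.\<close>
    have cl: "closure {X0<..<x} = {X0..x}" using x by simp
    have on': "h t \<le> h m / 2 + a * K / 2" if "t \<in> {X0..x}" for t
      by (rule continuous_le_on_closure[of "{X0<..<x}" h]) (use cl that on in \<open>auto intro: continuous_on_subset[OF h_cont]\<close>)
    have "h m \<le> B"
    proof (cases "m \<le> X0")
      case True then show ?thesis using m0[of m] m by (simp add: B_def)
    next
      \<comment> \<open>Applied at the maximiser itself, the bound absorbs its own first term and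
        leaves \<open>h m \<le> a * K\<close>.\<close>
      case False then have "h m \<le> h m / 2 + a * K / 2" using on'[of m] m by simp
      then show ?thesis by (simp add: B_def)
    qed
    then show ?thesis using m(3)[of x] x X0 by simp
  qed
  then have "h x \<le> B" if "x \<ge> 1" for x
    using m0[of x] that by (cases "x > X0") (auto simp: B_def)
  moreover have "B \<ge> 0" using h_nonneg[of m0] by (simp add: B_def)
  ultimately show ?thesis by blast
qed

text \<open>Since \<open>h\<close> is bounded on \<open>[1, \<infinity>)\<close>, the window
  \<open>d = 1\<close> bounds \<open>P\<close>; \<open>x > 2\<close> keeps the window in that
  range.\<close>

lemma h_le_inverse: "\<exists>D\<ge>0. \<forall>x>2. x * h x \<le> D"
proof -
  obtain B where B: "B \<ge> 0" "\<And>x. x \<ge> 1 \<Longrightarrow> h x \<le> B" using h_bounded by auto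
  define D where "D = a * (B / (1 - \<beta>) + K)"
  have "AE x in lborel. x \<in> {2<..} \<longrightarrow> x * h x \<le> D"
    using AE_h_le
  proof (rule AE_mp, intro AE_I2 impI)
    fix t assume t: "t > 0 \<longrightarrow> t * h t \<le> a * P t" "t \<in> {2<..}"
    have "P t \<le> B / (1 - \<beta>) + K"
      using P_le[of 1 t B] t B by auto
    then show "t * h t \<le> D"
      using t a unfolding D_def by (smt (verit) greaterThan_iff mult_left_mono)
  qed
  then have "x * h x \<le> D" if "x > 2" for x
    by (rule AE_open_imp_le[rotated 2]) (use that in \<open>auto intro!: continuous_intros continuous_on_subset[OF h_cont]\<close>)
  moreover have "D \<ge> 0" using a B \<beta> K_nonneg by (simp add: D_def)
  ultimately show ?thesis by blast
qed

text \<open>The window \<open>d = t / 2\<close> balances the two parts of \<open>P t\<close>: on it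
  \<open>h\<close> is at most \<open>2 * D / t\<close>, so the near part is of order
  \<open>t powr - \<beta>\<close>, like the far part. The equation then gains one more factor
  \<open>1 / t\<close>.\<close>

lemma h_le_powr: "\<exists>E\<ge>0. \<forall>x>4. h x \<le> E * x powr - (1 + \<beta>)"
proof -
  obtain D where D: "D \<ge> 0" "\<And>x. x > 2 \<Longrightarrow> x * h x \<le> D" using h_le_inverse by auto
  define E where "E = a * (D / (1 - \<beta>) + K) * 2 powr \<beta>"
  have "AE x in lborel. x \<in> {4<..} \<longrightarrow> x powr (1 + \<beta>) * h x \<le> E"
    using AE_h_le
  proof (rule AE_mp, intro AE_I2 impI)
    fix t assume t: "t > 0 \<longrightarrow> t * h t \<le> a * P t" "t \<in> {4<..}"
    have "h s \<le> D / (t / 2)" if "t / 2 \<le> s" for s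
    proof -
      have "t / 2 * h s \<le> s * h s" using that h_nonneg by (intro mult_right_mono) auto
      also have "\<dots> \<le> D" using D that t by auto
      finally show ?thesis using t by (simp add: field_simps)
    qed
    then have "P t \<le> D / (t / 2) * ((t / 2) powr (1 - \<beta>) / (1 - \<beta>)) + (t / 2) powr - \<beta> * K"
      using P_le[of "t / 2" t "D / (t / 2)"] t by auto
    also have "\<dots> = (t / 2) powr - \<beta> * (D / (1 - \<beta>) + K)"
    proof -
      have "(t / 2) powr (1 - \<beta>) = t / 2 * (t / 2) powr - \<beta>"
        using t powr_add[of "t / 2" 1 "- \<beta>"] by simp
      then show ?thesis using t \<beta> by (simp only:) (simp add: field_simps)
    qed
    also have "\<dots> = t powr - \<beta> * ((D / (1 - \<beta>) + K) * 2 powr \<beta>)"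
      using t by (simp add: powr_divide powr_minus field_simps)
    finally have "t * h t \<le> t powr - \<beta> * E"
      using t a unfolding E_def by (smt (verit) greaterThan_iff mult_left_mono mult.assoc mult.commute)
    then have "t powr \<beta> * (t * h t) \<le> t powr \<beta> * (t powr - \<beta> * E)"
      by (intro mult_left_mono) auto
    then show "t powr (1 + \<beta>) * h t \<le> E"
      using t by (simp add: powr_add powr_minus mult_ac)
  qed
  then have "x powr (1 + \<beta>) * h x \<le> E" if "x > 4" for x
    by (rule AE_open_imp_le[rotated 2]) (use that in \<open>auto intro!: continuous_intros continuous_on_subset[OF h_cont]\<close>)
  then have "h x \<le> E * x powr - (1 + \<beta>)" if "x > 4" for x
    using that by (simp only: powr_minus) (simp add: field_simps)
  moreover have "E \<ge> 0" using a D \<beta> K_nonneg by (simp add: E_def)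
  ultimately show ?thesis by blast
qed

text \<open>The substitution \<open>t = x - y\<close> turns the scaled far part into the integral of
  \<open>h t * (1 - t / x) powr - \<beta>\<close> over \<open>t < x / 2\<close>. There
  \<open>1 - t / x > 1 / 2\<close>, so \<open>2 powr \<beta> * h\<close> dominates and the limit is
  the mass of \<open>h\<close>.\<close>

lemma far_limit:
  "((\<lambda>x. x powr \<beta> * far (x/2) x) \<longlongrightarrow> K) at_top"
proof -
  define s where "s x t = indicator {..<x/2} t * (h t * (1 - t / x) powr - \<beta>)" for x t :: real
  have "((\<lambda>x. \<integral>t. s x t \<partial>lborel) \<longlongrightarrow> (\<integral>t. h t \<partial>lborel)) at_top"
  proof (rule integral_dominated_convergence_at_top)
    show "integrable lborel (\<lambda>t. 2 powr \<beta> * h t)" using h_int by simp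
    show "s x \<in> borel_measurable lborel" for x unfolding s_def by measurable
    show "AE t in lborel. ((\<lambda>x. s x t) \<longlongrightarrow> h t) at_top"
    proof (rule AE_I2)
      fix t
      have "((\<lambda>x. h t * (1 - t / x) powr - \<beta>) \<longlongrightarrow> h t * (1 - 0) powr - \<beta>) at_top"
        by (intro tendsto_intros tendsto_divide_0[OF tendsto_const] filterlim_at_top_imp_at_infinity filterlim_ident) auto
      moreover have "eventually (\<lambda>x. h t * (1 - t / x) powr - \<beta> = s x t) at_top"
        using eventually_gt_at_top[of "2 * t"] by eventually_elim (simp add: s_def)
      ultimately show "((\<lambda>x. s x t) \<longlongrightarrow> h t) at_top"
        using Lim_transform_eventually by fastforce
    qed
    show "\<forall>\<^sub>F x in at_top. AE t in lborel. norm (s x t) \<le> 2 powr \<beta> * h t"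
      using eventually_gt_at_top[of 0]
    proof eventually_elim
      fix x :: real assume x: "x > 0"
      have "(1 - t / x) powr - \<beta> \<le> 2 powr \<beta>" if "t < x / 2" for t
      proof -
        have "(1 - t / x) powr - \<beta> \<le> (1 / 2) powr - \<beta>"
          using that x \<beta> by (intro powr_mono2') (auto simp: field_simps)
        then show ?thesis by (simp add: powr_divide powr_minus)
      qed
      then have "norm (s x t) \<le> 2 powr \<beta> * h t" for t
        using h_nonneg[of t] by (auto simp: s_def indicator_def mult.commute[of "h _"] intro!: mult_right_mono)
      then show "AE t in lborel. norm (s x t) \<le> 2 powr \<beta> * h t" by auto
    qed
  qed auto
  moreover have "eventually (\<lambda>x. (\<integral>t. s x t \<partial>lborel) =
      x powr \<beta> * far (x/2) x) at_top"
    using eventually_gt_at_top[of 0]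
  proof eventually_elim
    fix x :: real assume x: "x > 0"
    have "(\<integral>t. s x t \<partial>lborel) = (\<integral>y. s x (x - y) \<partial>lborel)"
      using lborel_integral_real_affine[of "-1" "s x" x] by simp
    also have "\<dots> = (\<integral>y. x powr \<beta> * (indicator {x/2<..} y * (h (x - y) * y powr - \<beta>)) \<partial>lborel)"
    proof (rule Bochner_Integration.integral_cong[OF refl])
      fix y
      have "1 - (x - y) / x = y / x" using x by (simp add: field_simps)
      then show "s x (x - y) = x powr \<beta> * (indicator {x/2<..} y * (h (x - y) * y powr - \<beta>))"
        using x by (auto simp: s_def indicator_def powr_divide powr_minus field_simps)
    qed
    finally show "(\<integral>t. s x t \<partial>lborel) = x powr \<beta> * far (x/2) x"
      by (simp add: far_def)
  qed
  ultimately show ?thesis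
    unfolding K_def by (rule Lim_transform_eventually)
qed

text \<open>Only the far part survives multiplication by \<open>x powr \<beta>\<close>: by
  \<open>h_le_powr\<close> the near part is of order \<open>x powr (- 2 * \<beta>)\<close> and
  \<open>N x\<close> of order \<open>x powr - (1 + \<beta>)\<close>.\<close>

theorem tail_limit: "((\<lambda>x. x powr (1 + \<beta>) * h x) \<longlongrightarrow> a * K) at_top"
proof -
  obtain E where E: "E \<ge> 0" "\<And>x. x > 4 \<Longrightarrow> h x \<le> E * x powr - (1 + \<beta>)" using h_le_powr by auto
  define U where "U x = a * (x powr \<beta> * far (x/2) x) + a * E / (1 - \<beta>) * (x powr \<beta> * (x / 2) powr (- 2 * \<beta>))" for x
  define L where "L x = a * (x powr \<beta> * far (x/2) x) - b * E * (Gamma (1 - \<gamma>) / c powr (1 - \<gamma>)) * x powr -1" for x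
  have Ulim: "(U \<longlongrightarrow> a * K + a * E / (1 - \<beta>) * 0) at_top"
    unfolding U_def
  proof (intro tendsto_add tendsto_mult_left)
    show "((\<lambda>x. x powr \<beta> * far (x/2) x) \<longlongrightarrow> K) at_top" using far_limit by simp
    show "((\<lambda>x. x powr \<beta> * (x / 2) powr (- 2 * \<beta>)) \<longlongrightarrow> 0) at_top" using \<beta> by real_asymp
  qed
  have Llim: "(L \<longlongrightarrow> a * K - b * E * (Gamma (1 - \<gamma>) / c powr (1 - \<gamma>)) * 0) at_top"
    unfolding L_def
  proof (intro tendsto_diff tendsto_mult_left)
    show "((\<lambda>x. x powr \<beta> * far (x/2) x) \<longlongrightarrow> K) at_top" using far_limit by simp
    show "((\<lambda>x::real. x powr - 1) \<longlongrightarrow> 0) at_top" by real_asymp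
  qed
  \<comment> \<open>The threshold 8 makes \<open>x / 2 > 4\<close>, so that \<open>h_le_powr\<close>
    holds on the whole window.\<close>
  have sandwich: "AE x in lborel. x > 8 \<longrightarrow> L x \<le> x powr (1 + \<beta>) * h x \<and> x powr (1 + \<beta>) * h x \<le> U x"
    using renewal
  proof (rule AE_mp, intro AE_I2 impI)
    fix x assume *: "x > 0 \<longrightarrow> integrable lborel (\<lambda>y. indicator {0<..} y * (h (x - y) * y powr - \<beta>)) \<and> x * h x = a * P x - b * N x"
      and x: "x > 8"
    have int: "integrable lborel (\<lambda>y. indicator {0<..} y * (h (x - y) * y powr - \<beta>))"
      and eq: "x * h x = a * P x - b * N x" using * x by auto
    have hM: "h t \<le> E * z powr - (1 + \<beta>)" if "z > 4" "t \<ge> z" for t z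
    proof -
      have "h t \<le> E * t powr - (1 + \<beta>)" using E that by simp
      also have "\<dots> \<le> E * z powr - (1 + \<beta>)" using that \<beta> E by (intro mult_left_mono powr_mono2') auto
      finally show ?thesis .
    qed
    have split: "P x \<le> E * (x/2) powr - (1 + \<beta>) * ((x/2) powr (1 - \<beta>) / (1 - \<beta>)) + far (x/2) x"
      using x hM[of "x/2"] by (intro P_le_split(1)) auto
    have far: "integrable lborel (\<lambda>y. indicator {x/2<..} y * (h (x - y) * y powr - \<beta>))"
      using x hM[of "x/2"] by (intro integrable_far[of "x/2" x "E * (x/2) powr - (1 + \<beta>)"]) auto
    have PQ: "far (x/2) x \<le> P x"
      unfolding far_def P_def using h_nonneg x by (intro integral_mono far int) (auto simp: indicator_def)
    have N: "N x \<le> E * x powr - (1 + \<beta>) * (Gamma (1 - \<gamma>) / c powr (1 - \<gamma>))"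
      using x hM[of x] by (intro N_le) auto
    have xh: "x powr (1 + \<beta>) * h x = x powr \<beta> * (a * P x - b * N x)"
      using x eq by (simp add: powr_add mult_ac flip: eq)
    have "x powr \<beta> * (a * P x - b * N x) \<le> x powr \<beta> * (a * (E * (x/2) powr - (1 + \<beta>) * ((x/2) powr (1 - \<beta>) / (1 - \<beta>)) + far (x/2) x))"
      using split a b N_nonneg[of x] by (intro mult_left_mono) (smt (verit) mult_left_mono mult_nonneg_nonneg, auto)
    also have "\<dots> = a * (x powr \<beta> * far (x/2) x) + a * E / (1 - \<beta>) * (x powr \<beta> * ((x/2) powr - (1 + \<beta>) * (x/2) powr (1 - \<beta>)))"
      by (simp add: algebra_simps)
    also have "(x/2) powr - (1 + \<beta>) * (x/2) powr (1 - \<beta>) = (x/2) powr (- 2 * \<beta>)"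
      by (simp flip: powr_add)
    finally have up: "x powr \<beta> * (a * P x - b * N x) \<le> U x" by (simp add: U_def)
    have "L x = x powr \<beta> * (a * far (x/2) x - b * (E * x powr - (1 + \<beta>) * (Gamma (1 - \<gamma>) / c powr (1 - \<gamma>))))"
    proof -
      have "x powr -1 = x powr \<beta> * x powr - (1 + \<beta>)" by (simp flip: powr_add)
      then show ?thesis unfolding L_def by (simp add: algebra_simps)
    qed
    also have "\<dots> \<le> x powr \<beta> * (a * P x - b * N x)"
      using PQ N a b by (intro mult_left_mono diff_mono) auto
    finally show "L x \<le> x powr (1 + \<beta>) * h x \<and> x powr (1 + \<beta>) * h x \<le> U x"
      using up xh by simp
  qed
  have cont: "continuous_on {x0<..} (\<lambda>x. x powr (1 + \<beta>) * h x)" if "x0 \<ge> 8" for x0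
    using that by (intro continuous_intros continuous_on_subset[OF h_cont]) auto
  show ?thesis
  proof (rule order_tendstoI)
    fix l assume "l < a * K"
    \<comment> \<open>Passing from almost everywhere to everywhere keeps only a weak inequality; the
      intermediate \<open>l'\<close> restores strictness. Negation below puts a lower bound into the
      form of \<open>AE_open_imp_le\<close>.\<close>
    then obtain l' where l': "l < l'" "l' < a * K" using dense by blast
    then have "eventually (\<lambda>x. l' < L x) at_top"
      using order_tendstoD(1)[OF Llim, of l'] by simp
    then obtain x0 where x0: "\<And>x. x \<ge> x0 \<Longrightarrow> l' < L x" by (auto simp: eventually_at_top_linorder)
    have "AE x in lborel. x \<in> {max 8 x0<..} \<longrightarrow> - (x powr (1 + \<beta>) * h x) \<le> - l'"
      using sandwich
    proof (rule AE_mp, intro AE_I2 impI)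
      fix x assume "8 < x \<longrightarrow> L x \<le> x powr (1 + \<beta>) * h x \<and> x powr (1 + \<beta>) * h x \<le> U x"
        and "x \<in> {max 8 x0<..}"
      then show "- (x powr (1 + \<beta>) * h x) \<le> - l'" using x0[of x] by simp
    qed
    then have "- (x powr (1 + \<beta>) * h x) \<le> - l'" if "x \<in> {max 8 x0<..}" for x
      using that by (rule AE_open_imp_le[rotated 2]) (auto intro!: continuous_on_minus cont)
    then show "eventually (\<lambda>x. l < x powr (1 + \<beta>) * h x) at_top"
      using l' by (intro eventually_at_top_dense[THEN iffD2] exI[of _ "max 8 x0"]) force
  next
    fix l assume "a * K < l"
    then obtain l' where l': "l' < l" "a * K < l'" using dense by blast
    then have "eventually (\<lambda>x. U x < l') at_top"
      using order_tendstoD(2)[OF Ulim, of l'] by simp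
    then obtain x0 where x0: "\<And>x. x \<ge> x0 \<Longrightarrow> U x < l'" by (auto simp: eventually_at_top_linorder)
    have "AE x in lborel. x \<in> {max 8 x0<..} \<longrightarrow> x powr (1 + \<beta>) * h x \<le> l'"
      using sandwich
    proof (rule AE_mp, intro AE_I2 impI)
      fix x assume "8 < x \<longrightarrow> L x \<le> x powr (1 + \<beta>) * h x \<and> x powr (1 + \<beta>) * h x \<le> U x"
        and "x \<in> {max 8 x0<..}"
      then show "x powr (1 + \<beta>) * h x \<le> l'" using x0[of x] by simp
    qed
    then have "x powr (1 + \<beta>) * h x \<le> l'" if "x \<in> {max 8 x0<..}" for x
      using that by (rule AE_open_imp_le[rotated 2]) (auto intro!: cont)
    then show "eventually (\<lambda>x. x powr (1 + \<beta>) * h x < l) at_top"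
      using l' by (intro eventually_at_top_dense[THEN iffD2] exI[of _ "max 8 x0"]) force
  qed
qed

end

section \<open>Moments and characteristic functions\<close>

text \<open>Subtracting 1 makes the integrand at most \<open>\<bar>u * x\<bar>\<close>, hence
  integrable even for an infinite measure with a first moment. One lemma thus serves both the law
  and its Levy measure; the second moment controls the quadratic remainder.\<close>

lemma has_vector_derivative_fourier:
  fixes M :: "real measure"
  assumes [simp, measurable_cong]: "sets M = sets borel"
    and i1: "integrable M (\<lambda>x. x)" and i2: "integrable M (\<lambda>x. x\<^sup>2)"
  shows "((\<lambda>u. CLINT x|M. iexp (u * x) - 1) has_vector_derivative (CLINT x|M. \<i> * x * iexp (u * x))) (at u)"
proof (rule has_vector_derivative_quadratic[where C = "(\<integral>x. x\<^sup>2 \<partial>M) / 2"])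
  fix t :: real
  have I0: "complex_integrable M (\<lambda>x. iexp (s * x) - 1)" for s
  proof (rule Bochner_Integration.integrable_bound)
    show "integrable M (\<lambda>x. s * x)" using i1 by simp
    show "AE x in M. norm (iexp (s * x) - 1) \<le> norm (s * x)"
      using iexp_approx1[of "s * _" 0] by auto
  qed measurable
  have I1: "complex_integrable M (\<lambda>x. \<i> * x * iexp (s * x))" for s
    by (rule Bochner_Integration.integrable_bound[OF i1]) (auto simp: norm_mult)
  have "norm ((CLINT x|M. iexp (t * x) - 1) - (CLINT x|M. iexp (u * x) - 1) - (t - u) *\<^sub>R (CLINT x|M. \<i> * x * iexp (u * x)))
     = norm (CLINT x|M. (iexp (t * x) - 1) - (iexp (u * x) - 1) - (t - u) *\<^sub>R (\<i> * x * iexp (u * x)))"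
  proof -
    have "(CLINT x|M. p x) - (CLINT x|M. q x) - (t - u) *\<^sub>R (CLINT x|M. r x) = (CLINT x|M. p x - q x - (t - u) *\<^sub>R r x)"
      if "complex_integrable M p" "complex_integrable M q" "complex_integrable M r" for p q r
      using that by simp
    from this[OF I0 I0 I1] show ?thesis by (simp only:)
  qed
  also have "\<dots> \<le> (\<integral>x. (t - u)\<^sup>2 * x\<^sup>2 / 2 \<partial>M)"
  proof (rule Bochner_Integration.integral_norm_bound_integral)
    fix x :: real
    have "iexp (t * x) = iexp (u * x) * iexp ((t - u) * x)"
      by (simp add: algebra_simps flip: exp_add)
    then have "(iexp (t * x) - 1) - (iexp (u * x) - 1) - (t - u) *\<^sub>R (\<i> * x * iexp (u * x))
        = iexp (u * x) * (iexp ((t - u) * x) - (\<Sum>k\<le>1. (\<i> * complex_of_real ((t - u) * x))^k / fact k))"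
      by (simp add: algebra_simps scaleR_conv_of_real)
    then have "norm ((iexp (t * x) - 1) - (iexp (u * x) - 1) - (t - u) *\<^sub>R (\<i> * x * iexp (u * x)))
        = norm (iexp ((t - u) * x) - (\<Sum>k\<le>1. (\<i> * complex_of_real ((t - u) * x))^k / fact k))"
      by (simp add: norm_mult del: of_real_mult)
    also have "\<dots> \<le> \<bar>(t - u) * x\<bar> ^ Suc 1 / fact (Suc 1)"
      by (rule iexp_approx1)
    finally show "norm ((iexp (t * x) - 1) - (iexp (u * x) - 1) - (t - u) *\<^sub>R (\<i> * x * iexp (u * x))) \<le> (t - u)\<^sup>2 * x\<^sup>2 / 2"
      by (simp add: power_mult_distrib power2_eq_square abs_mult_self_eq flip: power2_eq_square)
  next
    show "complex_integrable M (\<lambda>x. (iexp (t * x) - 1) - (iexp (u * x) - 1) - (t - u) *\<^sub>R (\<i> * x * iexp (u * x)))"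
      by (intro Bochner_Integration.integrable_diff integrable_scaleR_right I0 I1)
  qed (use i2 in auto)
  also have "\<dots> = (\<integral>x. x\<^sup>2 \<partial>M) / 2 * (t - u)\<^sup>2" by simp
  finally show "norm ((CLINT x|M. iexp (t * x) - 1) - (CLINT x|M. iexp (u * x) - 1) - (t - u) *\<^sub>R (CLINT x|M. \<i> * x * iexp (u * x)))
     \<le> (\<integral>x. x\<^sup>2 \<partial>M) / 2 * (t - u)\<^sup>2" .
qed simp

text \<open>Fatou's lemma for \<open>f n x\<close>, which tends to \<open>x\<^sup>2\<close>: its
  integral is a rescaled \<open>1 - Re (char M t)\<close> at \<open>t = 1 / (n + 1)\<close> and so
  at most \<open>2 * C\<close>.\<close>

lemma second_moment_of_char:
  assumes "real_distribution M" and C: "\<And>t. 1 - Re (char M t) \<le> C * t\<^sup>2"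
  shows "integrable M (\<lambda>x. x\<^sup>2)"
proof -
  interpret real_distribution M by fact
  have Re_char: "1 - Re (char M t) = (\<integral>x. 1 - cos (t * x) \<partial>M)" and cos_int: "integrable M (\<lambda>x. 1 - cos (t * x))" for t
  proof -
    have I: "complex_integrable M (\<lambda>x. iexp (t * x))"
      by (rule integrable_const_bound[of _ 1]) auto
    have "integrable M (\<lambda>x. Re (iexp (t * x)))" "Re (char M t) = (\<integral>x. Re (iexp (t * x)) \<partial>M)"
      using I by (auto simp: char_def simp del: Re_exp)
    moreover have "measure M UNIV = 1" using prob_space by simp
    ultimately show "1 - Re (char M t) = (\<integral>x. 1 - cos (t * x) \<partial>M)" "integrable M (\<lambda>x. 1 - cos (t * x))"
      by (auto simp: Re_exp)
  qed
  define f where "f n x = 2 * (real n + 1)\<^sup>2 * (1 - cos (1 / (real n + 1) * x))" for n and x :: real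
  have f0: "f n x \<ge> 0" for n x by (simp add: f_def)
  have lim: "(\<lambda>n. f n x) \<longlonglongrightarrow> x\<^sup>2" for x
  proof -
    have "(\<lambda>n. f n x) \<longlonglongrightarrow> x * x" unfolding f_def by real_asymp
    then show ?thesis by (simp add: power2_eq_square)
  qed
  have "(\<integral>\<^sup>+x. ennreal (x\<^sup>2) \<partial>M) = (\<integral>\<^sup>+x. liminf (\<lambda>n. ennreal (f n x)) \<partial>M)"
    by (intro nn_integral_cong lim_imp_Liminf[symmetric] tendsto_ennrealI lim) auto
  also have "\<dots> \<le> liminf (\<lambda>n. \<integral>\<^sup>+x. ennreal (f n x) \<partial>M)"
    by (rule nn_integral_liminf) (simp add: f_def)
  also have "\<dots> \<le> liminf (\<lambda>n. ennreal (2 * C))"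
  proof (intro Liminf_mono always_eventually allI)
    fix n
    have "(\<integral>\<^sup>+x. ennreal (f n x) \<partial>M) = ennreal (\<integral>x. f n x \<partial>M)"
      using f0 cos_int[of "1 / (real n + 1)"] by (intro nn_integral_eq_integral) (auto simp: f_def)
    also have "(\<integral>x. f n x \<partial>M) = 2 * (real n + 1)\<^sup>2 * (1 - Re (char M (1 / (real n + 1))))"
      unfolding f_def Re_char by simp
    also have "\<dots> \<le> 2 * (real n + 1)\<^sup>2 * (C * (1 / (real n + 1))\<^sup>2)"
      by (intro mult_left_mono C) auto
    also have "\<dots> = 2 * C" by (simp add: power_divide)
    finally show "(\<integral>\<^sup>+x. ennreal (f n x) \<partial>M) \<le> ennreal (2 * C)" by (simp add: ennreal_leI)
  qed
  also have "\<dots> < \<infinity>" by (simp add: Liminf_const)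
  finally show ?thesis by (intro integrableI_nonneg) auto
qed

section \<open>Elementary inequalities for cosine and exponential\<close>

lemma one_minus_cos_le:
  fixes y :: real
  shows "1 - cos y \<le> y\<^sup>2 / 2"
proof -
  have "(sin (y / 2))\<^sup>2 \<le> (y / 2)\<^sup>2"
    by (rule abs_le_square_iff[THEN iffD1, OF abs_sin_x_le_abs_x])
  then show ?thesis using cos_double_sin[of "y / 2"] by (simp add: power_divide)
qed

text \<open>With \<open>w = a + i b\<close>, write \<open>1 - exp a * cos b\<close> as
  \<open>(1 - exp a) + exp a * (1 - cos b)\<close>.\<close>

lemma one_minus_Re_exp_le:
  assumes "Re w \<le> 0"
  shows "1 - Re (exp w) \<le> - Re w + (Im w)\<^sup>2 / 2"
proof -
  have "1 - cos (Im w) \<le> (Im w)\<^sup>2 / 2" by (rule one_minus_cos_le)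
  then have "exp (Re w) * (1 - cos (Im w)) \<le> 1 * ((Im w)\<^sup>2 / 2)"
    using assms by (intro mult_mono) auto
  moreover have "1 + Re w \<le> exp (Re w)" by (rule exp_ge_add_one_self)
  ultimately show ?thesis unfolding Re_exp right_diff_distrib by linarith
qed

text \<open>The factor \<open>1 + exp d\<close> is chosen so that, for
  \<open>d = (t - s) * x\<close>, multiplication by \<open>exp (s * x)\<close> gives
  \<open>exp (s * x) + exp (t * x)\<close>.\<close>

lemma exp_taylor1_bound:
  fixes d :: real
  shows "0 \<le> exp d - 1 - d" and "exp d - 1 - d \<le> d\<^sup>2 * (1 + exp d)"
proof -
  show "0 \<le> exp d - 1 - d" using exp_ge_add_one_self[of d] by linarith
  have "1 + (- d) \<le> exp (- d)" by (rule exp_ge_add_one_self)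
  then have "(1 - d) * exp d \<le> exp (-d) * exp d" by (intro mult_right_mono) auto
  then have le: "exp d - 1 \<le> d * exp d" by (simp add: algebra_simps flip: exp_add)
  have "d * (exp d - 1) \<le> d\<^sup>2 * (1 + exp d)"
  proof (cases "d \<ge> 0")
    case True
    have "d * (exp d - 1) \<le> d * (d * exp d)" using le True by (intro mult_left_mono)
    also have "\<dots> = d\<^sup>2 * exp d" by (simp add: power2_eq_square)
    also have "\<dots> \<le> d\<^sup>2 * (1 + exp d)" by (intro mult_left_mono) auto
    finally show ?thesis .
  next
    case False
    have "(- d) * (1 - exp d) \<le> (- d) * (- d)"
    proof (rule mult_left_mono)
      show "1 - exp d \<le> - d" using exp_ge_add_one_self[of d] by linarith
    qed (use False in simp)
    also have "\<dots> = d\<^sup>2 * 1" by (simp add: power2_eq_square)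
    also have "\<dots> \<le> d\<^sup>2 * (1 + exp d)" by (intro mult_left_mono) auto
    finally show ?thesis by (simp add: algebra_simps)
  qed
  then show "exp d - 1 - d \<le> d\<^sup>2 * (1 + exp d)" using le by (simp add: algebra_simps)
qed

lemma exp_mult_le_add:
  fixes r s x :: real
  assumes "0 \<le> r" "r \<le> s"
  shows "exp (r * x) \<le> 1 + exp (s * x)"
proof (cases "x \<ge> 0")
  case True
  then have "exp (r * x) \<le> exp (s * x)" using assms by (simp add: mult_right_mono)
  then show ?thesis by linarith
next
  case False
  then have "exp (r * x) \<le> exp 0" using assms by (subst exp_le_cancel_iff) (simp add: mult_nonneg_nonpos)
  then show ?thesis by (simp add: add_increasing2)
qed

section \<open>The convolution equation of the tempered stable density\<close>

text \<open>The Gamma density of shape \<open>a\<close> and rate \<open>l\<close> without its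
  normalising constant; it describes both halves of the kernel \<open>k\<close> and of its
  exponential tilts.\<close>

definition gamma_kernel :: "real \<Rightarrow> real \<Rightarrow> real \<Rightarrow> real" where
  "gamma_kernel a l x = indicator {0<..} x * (x powr (a - 1) * exp (- (l * x)))"

lemma gamma_kernel_nonneg: "gamma_kernel a l x \<ge> 0"
  by (simp add: gamma_kernel_def)

lemma has_bochner_integral_gamma_kernel:
  assumes "a > 0" "l > 0"
  shows "has_bochner_integral lborel (gamma_kernel a l) (Gamma a / l powr a)"
    and "has_bochner_integral lborel (\<lambda>x. gamma_kernel a l (- x)) (Gamma a / l powr a)"
proof -
  show *: "has_bochner_integral lborel (gamma_kernel a l) (Gamma a / l powr a)"
    using has_bochner_integral_Gamma[OF assms] by (simp add: gamma_kernel_def[abs_def])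
  then show "has_bochner_integral lborel (\<lambda>x. gamma_kernel a l (- x)) (Gamma a / l powr a)"
    using lborel_has_bochner_integral_real_affine_iff[of "-1" "gamma_kernel a l" "Gamma a / l powr a" 0] by simp
qed

locale tempered_stable_law =
  fixes \<alpha>p \<beta>p lp \<alpha>m \<beta>m lm :: real and M :: "real measure" and g :: "real \<Rightarrow> real"
  assumes \<alpha>p: "\<alpha>p > 0" and lp: "lp > 0" and \<alpha>m: "\<alpha>m > 0" and lm: "lm > 0"
    and \<beta>p: "0 < \<beta>p" "\<beta>p < 1" and \<beta>m: "0 < \<beta>m" "\<beta>m < 1"
    and ts: "tempered_stable \<alpha>p \<beta>p lp \<alpha>m \<beta>m lm M"
    and g_cont: "continuous_on UNIV g" and g_nonneg: "\<And>x. g x \<ge> 0"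
    and M_eq: "M = density lborel (\<lambda>x. ennreal (g x))"
begin

abbreviation f where "f \<equiv> ts_levy_density \<alpha>p \<beta>p lp \<alpha>m \<beta>m lm"
abbreviation F where "F \<equiv> ts_levy_measure \<alpha>p \<beta>p lp \<alpha>m \<beta>m lm"

definition k :: "real \<Rightarrow> real" where "k x = x * f x"

text \<open>The derivative of the cumulant generating function, obtained as the integral of
  \<open>exp (s * x) * k x\<close> for \<open>- lm < s < lp\<close>.\<close>

definition \<kappa> :: "real \<Rightarrow> real" where
  "\<kappa> s = \<alpha>p * (Gamma (1 - \<beta>p) / (lp - s) powr (1 - \<beta>p)) - \<alpha>m * (Gamma (1 - \<beta>m) / (lm + s) powr (1 - \<beta>m))"

lemma g_meas[measurable]: "g \<in> borel_measurable borel"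
  using borel_measurable_continuous_onI[OF g_cont] .

lemma f_meas[measurable]: "f \<in> borel_measurable borel"
  unfolding ts_levy_density_def[abs_def] by measurable

lemma k_meas[measurable]: "k \<in> borel_measurable borel"
  unfolding k_def[abs_def] by measurable

lemma f_nonneg: "f x \<ge> 0"
  using \<alpha>p \<alpha>m by (simp add: ts_levy_density_def)

text \<open>Multiplying by \<open>x\<close> lowers the singularity from order
  \<open>1 + \<beta>\<close> to \<beta>, which is integrable; the tilt only moves the two rates, in
  opposite directions.\<close>

lemma exp_k_eq:
  "exp (s * x) * k x = \<alpha>p * gamma_kernel (1 - \<beta>p) (lp - s) x - \<alpha>m * gamma_kernel (1 - \<beta>m) (lm + s) (- x)"
proof -
  consider "x > 0" | "x < 0" | "x = 0" by linarith
  then show ?thesis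
  proof cases
    case 1
    then have "exp (s * x) * k x = \<alpha>p * (x / x powr (1 + \<beta>p)) * (exp (s * x) * exp (- lp * x))"
      by (simp add: k_def ts_levy_density_def)
    also have "x / x powr (1 + \<beta>p) = x powr - \<beta>p"
      using 1 by (simp add: powr_add powr_minus field_simps)
    also have "exp (s * x) * exp (- lp * x) = exp (- ((lp - s) * x))"
      by (simp add: algebra_simps flip: exp_add)
    finally show ?thesis using 1 by (simp add: gamma_kernel_def)
  next
    case 2
    then have "exp (s * x) * k x = - \<alpha>m * (- x / (- x) powr (1 + \<beta>m)) * (exp (s * x) * exp (lm * x))"
      by (simp add: k_def ts_levy_density_def)
    also have "- x / (- x) powr (1 + \<beta>m) = (- x) powr - \<beta>m"
      using 2 powr_add[of "- x" 1 "\<beta>m"] by (simp only: powr_minus) (simp add: field_simps)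
    also have "exp (s * x) * exp (lm * x) = exp (- ((lm + s) * - x))"
      by (simp add: algebra_simps flip: exp_add)
    finally show ?thesis using 2 by (simp add: gamma_kernel_def)
  qed (simp add: gamma_kernel_def k_def)
qed

lemma sq_f_eq:
  "x\<^sup>2 * f x = \<alpha>p * gamma_kernel (2 - \<beta>p) lp x + \<alpha>m * gamma_kernel (2 - \<beta>m) lm (- x)"
proof -
  consider "x > 0" | "x < 0" | "x = 0" by linarith
  then show ?thesis
  proof cases
    case 1
    have "x * gamma_kernel (1 - \<beta>p) lp x = gamma_kernel (2 - \<beta>p) lp x"
      using 1 powr_add[of x 1 "- \<beta>p"] by (simp add: gamma_kernel_def)
    moreover have "x\<^sup>2 * f x = x * k x" by (simp add: k_def power2_eq_square)
    ultimately show ?thesis using exp_k_eq[of 0 x] 1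
      by (simp add: algebra_simps) (simp add: gamma_kernel_def)
  next
    case 2
    have 0: "gamma_kernel a l x = 0" for a l using 2 by (simp add: gamma_kernel_def)
    have "x\<^sup>2 * f x = x * k x" by (simp add: k_def power2_eq_square)
    also have "\<dots> = \<alpha>m * ((- x) * gamma_kernel (1 - \<beta>m) lm (- x))"
      using exp_k_eq[of 0 x] 0 by simp
    also have "(- x) * gamma_kernel (1 - \<beta>m) lm (- x) = gamma_kernel (2 - \<beta>m) lm (- x)"
      using 2 powr_add[of "- x" 1 "- \<beta>m"] by (simp add: gamma_kernel_def)
    finally show ?thesis using 0 by simp
  qed (simp add: gamma_kernel_def)
qed

lemma exp_k_integral:
  assumes "- lm < s" "s < lp"
  shows "has_bochner_integral lborel (\<lambda>x. exp (s * x) * k x) (\<kappa> s)"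
  unfolding exp_k_eq \<kappa>_def using assms \<beta>p \<beta>m
  by (intro has_bochner_integral_diff has_bochner_integral_mult_right has_bochner_integral_gamma_kernel) auto

lemma k_int: "integrable lborel k"
  using exp_k_integral[of 0] lp lm by (auto simp: has_bochner_integral_iff)

lemma F_sets[simp, measurable_cong]: "sets F = sets borel"
  by (simp add: ts_levy_measure_def)

lemma F_integral:
  fixes u :: "real \<Rightarrow> 'a::{banach, second_countable_topology}"
  assumes [measurable]: "u \<in> borel_measurable borel"
  shows "integrable F u \<longleftrightarrow> integrable lborel (\<lambda>x. f x *\<^sub>R u x)"
    and "integral\<^sup>L F u = (\<integral>x. f x *\<^sub>R u x \<partial>lborel)"
  unfolding ts_levy_measure_def using f_nonneg
  by (subst integrable_density integral_density; simp)+

lemma F_moments: "integrable F (\<lambda>x. x)" "integrable F (\<lambda>x. x\<^sup>2)"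
proof -
  show "integrable F (\<lambda>x. x)"
    using k_int by (simp add: F_integral k_def[abs_def] mult.commute)
  have "integrable lborel (\<lambda>x. x\<^sup>2 * f x)"
    unfolding sq_f_eq using \<beta>p \<beta>m lp lm
    by (intro Bochner_Integration.integrable_add integrable_mult_right
        integrable.intros[OF has_bochner_integral_gamma_kernel(1)] integrable.intros[OF has_bochner_integral_gamma_kernel(2)]) auto
  then show "integrable F (\<lambda>x. x\<^sup>2)"
    by (simp add: F_integral mult.commute)
qed

section \<open>The characteristic exponent and the moments of the law\<close>

definition \<psi> :: "real \<Rightarrow> complex" where "\<psi> u = (CLINT x|F. iexp (u * x) - 1)"

lemma char_eq: "char M u = exp (\<psi> u)"
  using ts by (simp add: tempered_stable_def \<psi>_def)

sublocale real_distribution M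
  using ts by (simp add: tempered_stable_def)

lemma M_integral:
  fixes u :: "real \<Rightarrow> 'a::{banach, second_countable_topology}"
  assumes [measurable]: "u \<in> borel_measurable borel"
  shows "integrable M u \<longleftrightarrow> integrable lborel (\<lambda>x. g x *\<^sub>R u x)"
    and "integral\<^sup>L M u = (\<integral>x. g x *\<^sub>R u x \<partial>lborel)"
  unfolding M_eq using g_nonneg
  by (subst integrable_density integral_density; simp)+

lemma g_int: "integrable lborel g" "(\<integral>x. g x \<partial>lborel) = 1"
  using M_integral[of "\<lambda>_. 1 :: real"] prob_space by auto

lemma \<psi>_integrable: "complex_integrable F (\<lambda>x. iexp (u * x) - 1)"
proof (rule Bochner_Integration.integrable_bound)
  show "integrable F (\<lambda>x. u * x)" using F_moments by simp
  show "AE x in F. norm (iexp (u * x) - 1) \<le> norm (u * x)"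
    using iexp_approx1[of "u * _" 0] by auto
qed measurable

lemma Re_\<psi>: "- Re (\<psi> u) = (\<integral>x. 1 - cos (u * x) \<partial>F)"
proof -
  have "Re (\<psi> u) = (\<integral>x. Re (iexp (u * x) - 1) \<partial>F)"
    unfolding \<psi>_def using \<psi>_integrable by (intro integral_Re[symmetric])
  then show ?thesis by (simp add: Re_exp flip: Bochner_Integration.integral_minus)
qed

text \<open>The second moment of \<open>F\<close> makes \<open>Re (\<psi> t)\<close> quadratic in
  \<open>t\<close>, and the first moment makes \<open>Im (\<psi> t)\<close> linear, so its square is
  quadratic as well.\<close>

lemma M_second_moment: "integrable M (\<lambda>x. x\<^sup>2)"
proof (rule second_moment_of_char[OF real_distribution_axioms])
  fix t
  define A where "A = (\<integral>x. \<bar>x\<bar> \<partial>F)"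
  define B where "B = (\<integral>x. x\<^sup>2 \<partial>F)"
  have "norm (\<psi> t) \<le> (\<integral>x. \<bar>t\<bar> * \<bar>x\<bar> \<partial>F)"
    unfolding \<psi>_def
    using iexp_approx1[of "t * _" 0] F_moments(1) \<psi>_integrable
    by (intro Bochner_Integration.integral_norm_bound_integral) (auto simp: abs_mult)
  then have "\<bar>Im (\<psi> t)\<bar> \<le> \<bar>t\<bar> * A"
    using abs_Im_le_cmod[of "\<psi> t"] by (simp add: A_def)
  then have Im: "(Im (\<psi> t))\<^sup>2 \<le> A\<^sup>2 * t\<^sup>2"
    using abs_le_square_iff[of "Im (\<psi> t)" "t * A"] by (simp add: abs_mult A_def power_mult_distrib mult.commute)
  have "- Re (\<psi> t) \<le> (\<integral>x. t\<^sup>2 / 2 * x\<^sup>2 \<partial>F)"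
    unfolding Re_\<psi> using F_moments(2) one_minus_cos_le[of "t * _"]
    by (intro integral_mono') (auto simp: power_mult_distrib)
  then have Re: "- Re (\<psi> t) \<le> B / 2 * t\<^sup>2" by (simp add: B_def mult.commute)
  have "Re (\<psi> t) \<le> 0"
  proof -
    have "0 \<le> (\<integral>x. 1 - cos (t * x) \<partial>F)" by (intro integral_nonneg_AE) auto
    then show ?thesis unfolding Re_\<psi>[symmetric] by simp
  qed
  then have "1 - Re (char M t) \<le> - Re (\<psi> t) + (Im (\<psi> t))\<^sup>2 / 2"
    unfolding char_eq by (rule one_minus_Re_exp_le)
  then show "1 - Re (char M t) \<le> (B / 2 + A\<^sup>2 / 2) * t\<^sup>2"
    using Re Im by (simp add: distrib_right)
qed

lemma M_first_moment: "integrable M (\<lambda>x. x)"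
proof (rule Bochner_Integration.integrable_bound)
  show "integrable M (\<lambda>x. 1 + x\<^sup>2)" using M_second_moment by simp
  have "\<bar>x\<bar> \<le> 1 + x\<^sup>2" for x :: real
    using zero_le_power2[of "\<bar>x\<bar> - 1 / 2"] by (simp add: power2_eq_square algebra_simps)
  then show "AE x in M. norm x \<le> norm (1 + x\<^sup>2)" by (simp add: add_nonneg_nonneg)
qed simp

text \<open>The derivative of \<open>char M = exp \<psi>\<close> is computed twice, under the
  integral with respect to \<open>M\<close> and by the chain rule with the derivative of \<psi>
  taken under the integral with respect to \<open>F\<close>.\<close>

lemma fourier_equation:
  "(CLBINT x. iexp (u * x) * of_real (x * g x)) =
    (CLBINT x. iexp (u * x) * of_real (g x)) * (CLBINT x. iexp (u * x) * of_real (k x))"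
proof -
  have "((\<lambda>u. CLINT x|M. iexp (u * x) - 1) has_vector_derivative (CLINT x|M. \<i> * x * iexp (u * x))) (at u)"
    by (rule has_vector_derivative_fourier) (simp_all add: M_first_moment M_second_moment)
  moreover have "(CLINT x|M. iexp (u * x) - 1) = exp (\<psi> u) - 1" for u
  proof -
    have "complex_integrable M (\<lambda>x. iexp (u * x))"
      by (rule integrable_const_bound[of _ 1]) auto
    then show ?thesis
      using prob_space by (simp add: char_def flip: char_eq)
  qed
  ultimately have d1: "((\<lambda>u. exp (\<psi> u) - 1) has_vector_derivative (CLINT x|M. \<i> * x * iexp (u * x))) (at u)"
    by (simp only:)
  have "(\<psi> has_vector_derivative (CLINT x|F. \<i> * x * iexp (u * x))) (at u)"
    unfolding \<psi>_def[abs_def] by (rule has_vector_derivative_fourier) (simp_all add: F_moments)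
  then have "(((\<lambda>w. exp w - 1) \<circ> \<psi>) has_vector_derivative (CLINT x|F. \<i> * x * iexp (u * x)) * exp (\<psi> u)) (at u)"
    by (rule field_vector_diff_chain_at) (auto intro!: derivative_eq_intros)
  then have "(CLINT x|M. \<i> * x * iexp (u * x)) = (CLINT x|F. \<i> * x * iexp (u * x)) * char M u"
    using vector_derivative_unique_at[OF d1] by (simp add: o_def char_eq)
  also have "(CLINT x|M. \<i> * x * iexp (u * x)) = \<i> * (CLBINT x. iexp (u * x) * of_real (x * g x))"
    by (subst M_integral) (auto simp: scaleR_conv_of_real mult_ac simp flip: integral_mult_right_zero)
  also have "(CLINT x|F. \<i> * x * iexp (u * x)) = \<i> * (CLBINT x. iexp (u * x) * of_real (k x))"
    by (subst F_integral) (auto simp: scaleR_conv_of_real k_def mult_ac simp flip: integral_mult_right_zero)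
  also have "char M u = (CLBINT x. iexp (u * x) * of_real (g x))"
    unfolding char_def by (subst M_integral) (auto simp: scaleR_conv_of_real mult_ac)
  finally show ?thesis by simp
qed

lemma xg_int: "integrable lborel (\<lambda>x. x * g x)"
  using M_first_moment by (simp add: M_integral mult.commute)

text \<open>Both sides are integrable. Splitting \<open>iexp (u * x)\<close> along
  \<open>x = (x - y) + y\<close> makes the transform of the right side a product, which
  \<open>fourier_equation\<close> matches with the left side.\<close>

lemma convolution_equation: "AE x in lborel. x * g x = (\<integral>y. g (x - y) * k y \<partial>lborel)"
proof -
  define c where "c x = (\<integral>y. g (x - y) * k y \<partial>lborel)" for x
  have c_int: "integrable lborel c"
    unfolding c_def using g_int k_int by (intro integrable_convolution)
  have "AE x in lborel. x * g x - c x = 0"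
  proof (rule fourier_L1_unique)
    show "integrable lborel (\<lambda>x. x * g x - c x)" using c_int xg_int by simp
    fix u
    have I: "complex_integrable lborel (\<lambda>x. iexp (u * x) * of_real (p x))" if "integrable lborel p" for p :: "real \<Rightarrow> real"
      using that by (intro Bochner_Integration.integrable_bound[OF that]) (auto simp: norm_mult)
    have "(CLBINT x. iexp (u * x) * of_real (c x)) =
       (CLBINT x. (CLBINT y. (iexp (u * (x - y)) * of_real (g (x - y))) * (iexp (u * y) * of_real (k y))))"
    proof (rule Bochner_Integration.integral_cong[OF refl])
      fix x
      have "iexp (u * x) * of_real (c x) = (CLBINT y. iexp (u * x) * of_real (g (x - y) * k y))"
        by (simp only: c_def integral_mult_right_zero integral_complex_of_real)
      also have "\<dots> = (CLBINT y. (iexp (u * (x - y)) * of_real (g (x - y))) * (iexp (u * y) * of_real (k y)))"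
      proof (rule Bochner_Integration.integral_cong[OF refl])
        fix y
        have "iexp (u * x) = iexp (u * (x - y)) * iexp (u * y)"
          by (simp add: algebra_simps flip: exp_add)
        then show "iexp (u * x) * of_real (g (x - y) * k y) = (iexp (u * (x - y)) * of_real (g (x - y))) * (iexp (u * y) * of_real (k y))"
          by simp
      qed
      finally show "iexp (u * x) * of_real (c x) = (CLBINT y. (iexp (u * (x - y)) * of_real (g (x - y))) * (iexp (u * y) * of_real (k y)))" .
    qed
    also have "\<dots> = (CLBINT x. iexp (u * x) * of_real (x * g x))"
      unfolding fourier_equation using I[OF g_int(1)] I[OF k_int] by (rule integral_convolution)
    finally have "(CLBINT x. iexp (u * x) * of_real (x * g x)) - (CLBINT x. iexp (u * x) * of_real (c x)) = 0"
      by simp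
    then show "(CLBINT x. iexp (u * x) * of_real (x * g x - c x)) = 0"
      unfolding of_real_diff right_diff_distrib
      by (subst Bochner_Integration.integral_diff[OF I[OF xg_int] I[OF c_int]])
  qed
  then show ?thesis by (simp add: c_def)
qed

section \<open>The moment generating function and the tilted density\<close>

lemma AE_g_kernel_int:
  "AE x in lborel. integrable lborel (\<lambda>y. g (x - y) * gamma_kernel (1 - \<beta>p) lp y)"
  "AE x in lborel. integrable lborel (\<lambda>y. g (x - y) * gamma_kernel (1 - \<beta>m) lm (- y))"
  using \<beta>p \<beta>m lp lm
  by (intro AE_integrable_convolution g_int integrable.intros[OF has_bochner_integral_gamma_kernel(1)]
      integrable.intros[OF has_bochner_integral_gamma_kernel(2)]; simp)+

text \<open>Separates positive and negative jumps: upper bounds discard the latter, and tilting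
  changes the two kernels differently.\<close>

lemma AE_xg_split:
  "AE x in lborel. x * g x = \<alpha>p * (\<integral>y. g (x - y) * gamma_kernel (1 - \<beta>p) lp y \<partial>lborel)
      - \<alpha>m * (\<integral>y. g (x - y) * gamma_kernel (1 - \<beta>m) lm (- y) \<partial>lborel)"
  using convolution_equation AE_g_kernel_int
proof eventually_elim
  case (elim x)
  have k_eq: "k y = \<alpha>p * gamma_kernel (1 - \<beta>p) lp y - \<alpha>m * gamma_kernel (1 - \<beta>m) lm (- y)" for y
    using exp_k_eq[of 0 y] by simp
  have "(\<integral>y. g (x - y) * k y \<partial>lborel) =
    (\<integral>y. \<alpha>p * (g (x - y) * gamma_kernel (1 - \<beta>p) lp y) - \<alpha>m * (g (x - y) * gamma_kernel (1 - \<beta>m) lm (- y)) \<partial>lborel)"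
    by (intro Bochner_Integration.integral_cong) (auto simp: k_eq algebra_simps)
  also have "\<dots> = \<alpha>p * (\<integral>y. g (x - y) * gamma_kernel (1 - \<beta>p) lp y \<partial>lborel)
      - \<alpha>m * (\<integral>y. g (x - y) * gamma_kernel (1 - \<beta>m) lm (- y) \<partial>lborel)"
    using elim by simp
  finally show ?case using elim by simp
qed

text \<open>
  The weight \<open>exp (s * min x X)\<close> is bounded and at most \<open>exp (s * min (x - y) X) * exp (s * y)\<close>
  for \<open>y \<ge> 0\<close>, so the convolution equation bounds the first weighted moment by \<open>c\<close> times the
  weighted mass \<open>J\<close>, with \<open>c\<close> independent of \<open>X\<close>; as that moment is also at least
  \<open>(c + 1) * J\<close> up to a constant, \<open>J\<close> is bounded.
\<close>

lemma truncated_mgf_bounded: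
  assumes s: "0 \<le> s" "s < lp"
  shows "\<exists>D. \<forall>X. (\<integral>x. exp (s * min x X) * g x \<partial>lborel) \<le> D"
    and truncated_mgf_int: "integrable lborel (\<lambda>x. exp (s * min x X) * g x)"
proof -
  define q where "q = gamma_kernel (1 - \<beta>p) (lp - s)"
  define c where "c = \<alpha>p * (\<integral>y. q y \<partial>lborel)"
  have q_int: "integrable lborel q"
    unfolding q_def using s \<beta>p by (intro integrable.intros[OF has_bochner_integral_gamma_kernel(1)]) auto
  have c0: "c \<ge> 0"
    unfolding c_def q_def using \<alpha>p gamma_kernel_nonneg by (intro mult_nonneg_nonneg integral_nonneg_AE) auto
  \<comment> \<open>Exceeding \<open>c\<close> by one leaves exactly one copy of the weighted mass
    in \<open>N * J - D \<le> c * J\<close>.\<close>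
  define N where "N = c + 1"
  define D where "D = exp (s * N) * (N + (\<integral>x. \<bar>x * g x\<bar> \<partial>lborel))"
  have p_int: "integrable lborel (\<lambda>x. exp (s * min x X) * g x)" for X
  proof (rule Bochner_Integration.integrable_bound)
    show "integrable lborel (\<lambda>x. exp (s * X) * g x)" using g_int by simp
    have "exp (s * min x X) \<le> exp (s * X)" for x using s by (simp add: mult_left_mono)
    then show "AE x in lborel. norm (exp (s * min x X) * g x) \<le> norm (exp (s * X) * g x)"
      using g_nonneg by (auto intro!: mult_right_mono)
  qed measurable
  then show "integrable lborel (\<lambda>x. exp (s * min x X) * g x)" .
  have "(\<integral>x. exp (s * min x X) * g x \<partial>lborel) \<le> D" for X
  proof -
    define p where "p x = exp (s * min x X) * g x" for x
    have pi: "integrable lborel p" unfolding p_def by (rule p_int)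
    have p0: "p x \<ge> 0" for x using g_nonneg by (simp add: p_def)
    \<comment> \<open>Below \<open>N\<close> the weight is at most \<open>exp (s * N)\<close>, so
      the error is integrable independently of \<open>X\<close>; its integral is \<open>D\<close>,
      as \<open>g\<close> has mass 1.\<close>
    have ptail: "N * p x - exp (s * N) * (N * g x + \<bar>x * g x\<bar>) \<le> x * p x" for x
    proof (cases "x \<ge> N")
      case True
      have "N * p x \<le> x * p x" using True p0 by (intro mult_right_mono)
      moreover have "0 \<le> exp (s * N) * (N * g x + \<bar>x * g x\<bar>)"
        using c0 g_nonneg[of x] by (simp add: N_def)
      ultimately show ?thesis by linarith
    next
      case False
      have "exp (s * min x X) \<le> exp (s * N)" using s False by (simp add: mult_left_mono)
      then have "(N - x) * p x \<le> (N - x) * (exp (s * N) * g x)"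
        unfolding p_def using False g_nonneg by (intro mult_left_mono mult_right_mono) auto
      also have "\<dots> \<le> (N + \<bar>x\<bar>) * (exp (s * N) * g x)"
        using g_nonneg by (intro mult_right_mono) auto
      finally show ?thesis using g_nonneg[of x] by (simp add: algebra_simps abs_mult)
    qed
    have "AE x in lborel. N * p x - exp (s * N) * (N * g x + \<bar>x * g x\<bar>) \<le> \<alpha>p * (\<integral>y. p (x - y) * q y \<partial>lborel)"
      using AE_xg_split AE_g_kernel_int(1) AE_integrable_convolution[OF pi q_int]
    proof eventually_elim
      case (elim x)
      have "x * g x \<le> \<alpha>p * (\<integral>y. g (x - y) * gamma_kernel (1 - \<beta>p) lp y \<partial>lborel)"
      proof -
        have "0 \<le> (\<integral>y. g (x - y) * gamma_kernel (1 - \<beta>m) lm (- y) \<partial>lborel)"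
          using g_nonneg gamma_kernel_nonneg by (intro integral_nonneg_AE) auto
        then show ?thesis using elim(1) \<alpha>m by simp
      qed
      then have "exp (s * min x X) * (x * g x) \<le> exp (s * min x X) * (\<alpha>p * (\<integral>y. g (x - y) * gamma_kernel (1 - \<beta>p) lp y \<partial>lborel))"
        by (intro mult_left_mono) auto
      also have "\<dots> = \<alpha>p * (\<integral>y. exp (s * min x X) * (g (x - y) * gamma_kernel (1 - \<beta>p) lp y) \<partial>lborel)"
        by simp
      also have "\<dots> \<le> \<alpha>p * (\<integral>y. p (x - y) * q y \<partial>lborel)"
      proof (intro mult_left_mono integral_mono)
        fix y
        show "exp (s * min x X) * (g (x - y) * gamma_kernel (1 - \<beta>p) lp y) \<le> p (x - y) * q y"
        proof (cases "y > 0")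
          case True
          have "s * min x X \<le> s * min (x - y) X + s * y"
            using s True by (simp add: min_def mult_left_mono flip: distrib_left)
          then have "exp (s * min x X) \<le> exp (s * min (x - y) X) * exp (s * y)"
            by (simp flip: exp_add)
          then have "exp (s * min x X) * (g (x - y) * gamma_kernel (1 - \<beta>p) lp y)
             \<le> exp (s * min (x - y) X) * exp (s * y) * (g (x - y) * gamma_kernel (1 - \<beta>p) lp y)"
            using g_nonneg gamma_kernel_nonneg by (intro mult_right_mono) auto
          also have "exp (s * y) * gamma_kernel (1 - \<beta>p) lp y = q y"
            using True by (simp add: gamma_kernel_def q_def algebra_simps flip: exp_add)
          then have "exp (s * min (x - y) X) * exp (s * y) * (g (x - y) * gamma_kernel (1 - \<beta>p) lp y) = p (x - y) * q y"
            by (simp add: p_def mult_ac flip: \<open>_ = q y\<close>)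
          finally show ?thesis .
        qed (simp add: gamma_kernel_def q_def)
      qed (use elim \<alpha>p in auto)
      finally show ?case using ptail[of x] by (simp add: p_def mult_ac)
    qed
    then have "(\<integral>x. N * p x - exp (s * N) * (N * g x + \<bar>x * g x\<bar>) \<partial>lborel) \<le> (\<integral>x. \<alpha>p * (\<integral>y. p (x - y) * q y \<partial>lborel) \<partial>lborel)"
      using pi g_int xg_int integrable_convolution[OF pi q_int]
      by (intro integral_mono_AE) auto
    also have "\<dots> = c * (\<integral>x. p x \<partial>lborel)"
      using integral_convolution[OF pi q_int] by (simp add: c_def)
    also have "(\<integral>x. N * p x - exp (s * N) * (N * g x + \<bar>x * g x\<bar>) \<partial>lborel) = N * (\<integral>x. p x \<partial>lborel) - D"
      using pi g_int xg_int by (simp add: D_def)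
    finally show ?thesis by (simp add: N_def distrib_right p_def)
  qed
  then show "\<exists>D. \<forall>X. (\<integral>x. exp (s * min x X) * g x \<partial>lborel) \<le> D" by blast
qed

text \<open>Fatou's lemma as the truncation level tends to infinity, using the uniform bound
  \<open>D\<close>.\<close>

lemma mgf_int:
  assumes s: "0 \<le> s" "s < lp"
  shows "integrable lborel (\<lambda>x. exp (s * x) * g x)"
proof -
  obtain D where D: "\<And>X. (\<integral>x. exp (s * min x X) * g x \<partial>lborel) \<le> D"
    using truncated_mgf_bounded[OF s] by blast
  have lim: "(\<lambda>n. exp (s * min x (real n)) * g x) \<longlonglongrightarrow> exp (s * x) * g x" for x
  proof (rule tendsto_eventually)
    obtain n0 :: nat where "x \<le> n0" using real_arch_simple by blast
    then show "\<forall>\<^sub>F n in sequentially. exp (s * min x (real n)) * g x = exp (s * x) * g x"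
      by (intro eventually_sequentiallyI[of n0]) (auto simp: min_def)
  qed
  have "(\<integral>\<^sup>+x. ennreal (exp (s * x) * g x) \<partial>lborel) = (\<integral>\<^sup>+x. liminf (\<lambda>n. ennreal (exp (s * min x (real n)) * g x)) \<partial>lborel)"
    by (intro nn_integral_cong lim_imp_Liminf[symmetric] tendsto_ennrealI lim) auto
  also have "\<dots> \<le> liminf (\<lambda>n. \<integral>\<^sup>+x. ennreal (exp (s * min x (real n)) * g x) \<partial>lborel)"
    by (rule nn_integral_liminf) measurable
  also have "\<dots> \<le> liminf (\<lambda>n. ennreal D)"
  proof (intro Liminf_mono always_eventually allI)
    fix n
    have "(\<integral>\<^sup>+x. ennreal (exp (s * min x (real n)) * g x) \<partial>lborel) = ennreal (\<integral>x. exp (s * min x (real n)) * g x \<partial>lborel)"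
      using g_nonneg by (intro nn_integral_eq_integral truncated_mgf_int[OF s]) auto
    also have "\<dots> \<le> ennreal D" by (intro ennreal_leI D)
    finally show "(\<integral>\<^sup>+x. ennreal (exp (s * min x (real n)) * g x) \<partial>lborel) \<le> ennreal D" .
  qed
  also have "\<dots> < \<infinity>" by (simp add: Liminf_const)
  finally show ?thesis using g_nonneg by (intro integrableI_nonneg) auto
qed

text \<open>On the positive side \<open>x\<^sup>2\<close> is absorbed by moving the exponent halfway
  towards \<open>lp\<close>; on the negative side the second moment of \<open>M\<close>
  suffices.\<close>

lemma mgf_sq_int:
  assumes s: "0 \<le> s" "s < lp"
  shows "integrable lborel (\<lambda>x. x\<^sup>2 * exp (s * x) * g x)"
proof (rule Bochner_Integration.integrable_bound)
  define d where "d = (lp - s) / 2"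
  have d: "d > 0" "s + d < lp" using s by (auto simp: d_def field_simps)
  have "integrable lborel (\<lambda>x. x\<^sup>2 * g x)"
    using M_second_moment by (simp add: M_integral mult.commute)
  then show "integrable lborel (\<lambda>x. x\<^sup>2 * g x + 2 / d\<^sup>2 * (exp ((s + d) * x) * g x))"
    using mgf_int[of "s + d"] s d by simp
  have "x\<^sup>2 * exp (s * x) \<le> x\<^sup>2 + 2 / d\<^sup>2 * exp ((s + d) * x)" for x
  proof (cases "x \<ge> 0")
    case True
    have "(d * x)\<^sup>2 / 2 \<le> exp (d * x)"
      using exp_lower_Taylor_quadratic[of "d * x"] d True by (smt (verit) mult_nonneg_nonneg)
    then have "x\<^sup>2 \<le> 2 / d\<^sup>2 * exp (d * x)"
      using d by (simp add: field_simps power_mult_distrib)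
    then have "x\<^sup>2 * exp (s * x) \<le> 2 / d\<^sup>2 * exp (d * x) * exp (s * x)"
      by (intro mult_right_mono) auto
    also have "\<dots> = 2 / d\<^sup>2 * exp ((s + d) * x)"
      by (simp add: algebra_simps flip: exp_add)
    finally show ?thesis by (simp add: add_increasing)
  next
    case False
    then have "s * x \<le> 0" using s by (simp add: mult_nonneg_nonpos)
    then have "x\<^sup>2 * exp (s * x) \<le> x\<^sup>2 * 1" by (intro mult_left_mono) auto
    moreover have "0 \<le> 2 / d\<^sup>2 * exp ((s + d) * x)" by simp
    ultimately show ?thesis by linarith
  qed
  then have "x\<^sup>2 * exp (s * x) * g x \<le> (x\<^sup>2 + 2 / d\<^sup>2 * exp ((s + d) * x)) * g x" for x
    using g_nonneg by (intro mult_right_mono) auto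
  then show "AE x in lborel. norm (x\<^sup>2 * exp (s * x) * g x) \<le> norm (x\<^sup>2 * g x + 2 / d\<^sup>2 * (exp ((s + d) * x) * g x))"
    using g_nonneg by (auto simp: distrib_right mult.assoc)
qed measurable

section \<open>The differential equation of the moment generating function and its solution\<close>

definition m :: "real \<Rightarrow> real" where "m s = (\<integral>x. exp (s * x) * g x \<partial>lborel)"

text \<open>The weight \<open>exp (s * x)\<close> factors along \<open>x = (x - y) + y\<close>, so
  the tilted convolution equation is again a convolution and its integral is a product.\<close>

lemma mgf_equation:
  assumes s: "0 \<le> s" "s < lp"
  shows "(\<integral>x. x * exp (s * x) * g x \<partial>lborel) = m s * \<kappa> s"
    and mgf_x_int: "integrable lborel (\<lambda>x. x * exp (s * x) * g x)"
proof -
  have eq: "AE x in lborel. x * exp (s * x) * g x = (\<integral>y. (exp (s * (x - y)) * g (x - y)) * (exp (s * y) * k y) \<partial>lborel)"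
    using convolution_equation
  proof eventually_elim
    case (elim x)
    have "(\<integral>y. (exp (s * (x - y)) * g (x - y)) * (exp (s * y) * k y) \<partial>lborel) = (\<integral>y. exp (s * x) * (g (x - y) * k y) \<partial>lborel)"
    proof (rule Bochner_Integration.integral_cong[OF refl])
      fix y
      have "exp (s * x) = exp (s * (x - y)) * exp (s * y)"
        by (simp add: algebra_simps flip: exp_add)
      then show "(exp (s * (x - y)) * g (x - y)) * (exp (s * y) * k y) = exp (s * x) * (g (x - y) * k y)"
        by simp
    qed
    also have "\<dots> = x * exp (s * x) * g x" using elim by simp
    finally show ?case by simp
  qed
  have k: "integrable lborel (\<lambda>x. exp (s * x) * k x)" "(\<integral>x. exp (s * x) * k x \<partial>lborel) = \<kappa> s"
    using exp_k_integral[of s] s lm by (auto simp: has_bochner_integral_iff)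
  note c = integrable_convolution[OF mgf_int[OF s] k(1)] integral_convolution[OF mgf_int[OF s] k(1)]
  have meas: "(\<lambda>x. x * exp (s * x) * g x) \<in> borel_measurable lborel" by measurable
  show "integrable lborel (\<lambda>x. x * exp (s * x) * g x)"
    using c(1) by (subst integrable_cong_AE[OF meas _ eq]) auto
  show "(\<integral>x. x * exp (s * x) * g x \<partial>lborel) = m s * \<kappa> s"
    using c by (subst integral_cong_AE[OF meas _ eq]) (auto simp: m_def k)
qed

text \<open>The Taylor remainder involves only exponents in \<open>{0..s1}\<close>, all dominated by
  \<open>1 + exp (s1 * x)\<close>; hence the weighted second moments at \<open>0\<close> and
  \<open>s1\<close> in the constant.\<close>

lemma m_deriv:
  assumes s1: "s1 < lp" and s: "s \<in> {0..s1}"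
  shows "(m has_real_derivative m s * \<kappa> s) (at s within {0..s1})"
  unfolding has_real_derivative_iff_has_vector_derivative
proof (rule has_vector_derivative_quadratic[where C = "2 * (\<integral>x. x\<^sup>2 * exp (0 * x) * g x \<partial>lborel) + 2 * (\<integral>x. x\<^sup>2 * exp (s1 * x) * g x \<partial>lborel)", OF s])
  fix t assume t: "t \<in> {0..s1}"
  have int: "integrable lborel (\<lambda>x. exp (t * x) * g x)" "integrable lborel (\<lambda>x. exp (s * x) * g x)"
    "integrable lborel (\<lambda>x. x * exp (s * x) * g x)" "integrable lborel (\<lambda>x. x\<^sup>2 * exp (0 * x) * g x)"
    "integrable lborel (\<lambda>x. x\<^sup>2 * exp (s1 * x) * g x)"
    using mgf_int[of t] mgf_int[of s] mgf_x_int[of s] mgf_sq_int[of 0] mgf_sq_int[of s1] s s1 t lp by auto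
  have "norm (m t - m s - (t - s) *\<^sub>R (m s * \<kappa> s)) = norm (\<integral>x. exp (t * x) * g x - exp (s * x) * g x - (t - s) * (x * exp (s * x) * g x) \<partial>lborel)"
    using int mgf_equation[of s] s s1 by (simp add: m_def)
  also have "\<dots> \<le> (\<integral>x. 2 * (t - s)\<^sup>2 * (x\<^sup>2 * exp (0 * x) * g x) + 2 * (t - s)\<^sup>2 * (x\<^sup>2 * exp (s1 * x) * g x) \<partial>lborel)"
  proof (rule Bochner_Integration.integral_norm_bound_integral)
    fix x
    define d where "d = (t - s) * x"
    have t_eq: "exp (t * x) = exp (s * x) * exp d"
      by (simp add: d_def algebra_simps flip: exp_add)
    have b: "exp (r * x) \<le> 1 + exp (s1 * x)" if "r \<in> {0..s1}" for r
      using that by (intro exp_mult_le_add) auto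
    have "exp (t * x) * g x - exp (s * x) * g x - (t - s) * (x * exp (s * x) * g x) = exp (s * x) * g x * (exp d - 1 - d)"
      by (simp add: t_eq d_def algebra_simps)
    then have "norm (exp (t * x) * g x - exp (s * x) * g x - (t - s) * (x * exp (s * x) * g x)) = exp (s * x) * g x * (exp d - 1 - d)"
      using g_nonneg[of x] exp_taylor1_bound(1)[of d] by (simp add: abs_mult)
    also have "\<dots> \<le> exp (s * x) * g x * (d\<^sup>2 * (1 + exp d))"
      using g_nonneg exp_taylor1_bound(2) by (intro mult_left_mono) auto
    also have "\<dots> = d\<^sup>2 * g x * (exp (s * x) + exp (t * x))"
      by (simp add: t_eq algebra_simps)
    also have "\<dots> \<le> d\<^sup>2 * g x * ((1 + exp (s1 * x)) + (1 + exp (s1 * x)))"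
      using b[OF s] b[OF t] g_nonneg by (intro mult_left_mono add_mono) auto
    also have "\<dots> = 2 * (t - s)\<^sup>2 * (x\<^sup>2 * exp (0 * x) * g x) + 2 * (t - s)\<^sup>2 * (x\<^sup>2 * exp (s1 * x) * g x)"
      unfolding d_def power_mult_distrib by (simp only: mult_zero_left exp_zero) algebra
    finally show "norm (exp (t * x) * g x - exp (s * x) * g x - (t - s) * (x * exp (s * x) * g x)) \<le>
      2 * (t - s)\<^sup>2 * (x\<^sup>2 * exp (0 * x) * g x) + 2 * (t - s)\<^sup>2 * (x\<^sup>2 * exp (s1 * x) * g x)" .
  next
    show "integrable lborel (\<lambda>x. exp (t * x) * g x - exp (s * x) * g x - (t - s) * (x * exp (s * x) * g x))"
      by (intro Bochner_Integration.integrable_diff integrable_mult_right int)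
    show "integrable lborel (\<lambda>x. 2 * (t - s)\<^sup>2 * (x\<^sup>2 * exp (0 * x) * g x) + 2 * (t - s)\<^sup>2 * (x\<^sup>2 * exp (s1 * x) * g x))"
      by (intro Bochner_Integration.integrable_add integrable_mult_right int)
  qed
  also have "\<dots> = (2 * (\<integral>x. x\<^sup>2 * exp (0 * x) * g x \<partial>lborel) + 2 * (\<integral>x. x\<^sup>2 * exp (s1 * x) * g x \<partial>lborel)) * (t - s)\<^sup>2"
    by (subst Bochner_Integration.integral_add[OF integrable_mult_right integrable_mult_right], rule int, rule int)
       (unfold integral_mult_right_zero, algebra)
  finally show "norm (m t - m s - (t - s) *\<^sub>R (m s * \<kappa> s)) \<le> (2 * (\<integral>x. x\<^sup>2 * exp (0 * x) * g x \<partial>lborel) + 2 * (\<integral>x. x\<^sup>2 * exp (s1 * x) * g x \<partial>lborel)) * (t - s)\<^sup>2" .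
qed

text \<open>The cumulant generating function: the antiderivative of \<kappa> that vanishes at 0.
  Unlike \<kappa>, it has a finite limit at \<open>lp\<close>, where
  \<open>(lp - s) powr \<beta>p\<close> tends to 0.\<close>

definition \<Lambda> :: "real \<Rightarrow> real" where
  "\<Lambda> s = \<alpha>p * Gamma (- \<beta>p) * ((lp - s) powr \<beta>p - lp powr \<beta>p) + \<alpha>m * Gamma (- \<beta>m) * ((lm + s) powr \<beta>m - lm powr \<beta>m)"

lemma \<Lambda>_deriv:
  assumes s: "0 \<le> s" "s < lp"
  shows "(\<Lambda> has_real_derivative \<kappa> s) (at s within S)"
proof -
  \<comment> \<open>The functional equation at \<open>- b\<close>, which lies strictly between -1
    and 0 and so is not a pole.\<close>
  have G: "Gamma (1 - b) = - b * Gamma (- b)" if "0 < b" "b < 1" for b :: real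
  proof -
    have False if "- b = of_int n" for n
    proof -
      have "of_int (-1) < (of_int n :: real)" "of_int n < (of_int 0 :: real)"
        unfolding that[symmetric] using \<open>0 < b\<close> \<open>b < 1\<close> by auto
      then show False unfolding of_int_less_iff by linarith
    qed
    then have "- b \<notin> \<int>\<^sub>\<le>\<^sub>0" by (auto elim: nonpos_Ints_cases)
    from Gamma_plus1[OF this] show ?thesis by simp
  qed
  have "(\<Lambda> has_real_derivative
      \<alpha>p * Gamma (- \<beta>p) * (\<beta>p * (lp - s) powr (\<beta>p - 1) * (- 1)) + \<alpha>m * Gamma (- \<beta>m) * (\<beta>m * (lm + s) powr (\<beta>m - 1) * 1)) (at s within S)"
    unfolding \<Lambda>_def[abs_def] using s lm by (auto intro!: derivative_eq_intros)
  moreover have "z powr (b - 1) = inverse (z powr (1 - b))" for z b :: real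
    using powr_minus[of z "1 - b"] by simp
  ultimately show ?thesis using G[OF \<beta>p] G[OF \<beta>m] by (simp add: \<kappa>_def divide_inverse algebra_simps)
qed

text \<open>With the integrating factor \<open>exp (- \<Lambda> s)\<close> the product has
  derivative 0 and takes the value 1 at 0.\<close>

lemma m_eq:
  assumes s1: "0 \<le> s1" "s1 < lp"
  shows "m s1 = exp (\<Lambda> s1)"
proof -
  have "((\<lambda>s. m s * exp (- \<Lambda> s)) has_real_derivative 0) (at s within {0..s1})" if "s \<in> {0..s1}" for s
    using that s1 m_deriv[of s1 s] by (auto intro!: derivative_eq_intros \<Lambda>_deriv)
  then obtain c where c: "\<And>s. s \<in> {0..s1} \<Longrightarrow> m s * exp (- \<Lambda> s) = c"
    using has_field_derivative_zero_constant[of "{0..s1}" "\<lambda>s. m s * exp (- \<Lambda> s)"] by auto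
  have "m 0 = 1" "\<Lambda> 0 = 0" using g_int by (auto simp: m_def \<Lambda>_def)
  then have "m s1 * exp (- \<Lambda> s1) = 1" using c[of 0] c[of s1] s1 by simp
  then show ?thesis by (simp add: exp_minus field_simps)
qed

section \<open>The tilted density: total mass and renewal equation\<close>

definition h :: "real \<Rightarrow> real" where "h x = exp (lp * x) * g x"

lemma h_nonneg: "h x \<ge> 0" using g_nonneg by (simp add: h_def)

lemma h_cont: "continuous_on UNIV h"
  unfolding h_def[abs_def] by (intro continuous_intros g_cont)

text \<open>Along \<open>s n\<close> tending to \<open>lp\<close> the values
  \<open>m (s n) = exp (\<Lambda> (s n))\<close> converge, so Fatou's lemma gives integrability.
  Then \<open>g + h\<close> is an integrable majorant and dominated convergence identifies the
  integral.\<close>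

lemma h_integral: "has_bochner_integral lborel h (exp (\<Lambda> lp))"
proof -
  define s where "s n = lp * (1 - 1 / real (n + 2))" for n
  have s: "0 \<le> s n" "s n < lp" for n
    using lp by (auto simp: s_def field_simps)
  have "(\<lambda>n. lp * (1 - 1 / real (n + 2))) \<longlonglongrightarrow> lp * (1 - 0)"
    by (intro tendsto_intros LIMSEQ_ignore_initial_segment[of "\<lambda>n. 1 / real n"] lim_1_over_n)
  then have s_lim: "s \<longlonglongrightarrow> lp" by (simp add: s_def[abs_def])
  \<comment> \<open>The base tends to 0, where continuity of \<open>powr\<close> needs nonnegative
    bases and a positive exponent.\<close>
  have powr_lim: "(\<lambda>n. (lp - s n) powr \<beta>p) \<longlonglongrightarrow> (lp - lp) powr \<beta>p"
    using s \<beta>p by (intro tendsto_powr' tendsto_diff tendsto_const s_lim) (auto simp: less_imp_le)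
  have "(\<lambda>n. \<Lambda> (s n)) \<longlonglongrightarrow> \<Lambda> lp"
    unfolding \<Lambda>_def using lm lp
    by (intro powr_lim tendsto_add tendsto_mult_left tendsto_diff tendsto_const tendsto_powr s_lim) auto
  then have m_lim: "(\<lambda>n. m (s n)) \<longlonglongrightarrow> exp (\<Lambda> lp)"
    using s by (simp add: m_eq tendsto_exp)
  have pt: "(\<lambda>n. exp (s n * x) * g x) \<longlonglongrightarrow> h x" for x
    unfolding h_def by (intro tendsto_intros s_lim)
  have "(\<integral>\<^sup>+x. ennreal (h x) \<partial>lborel) = (\<integral>\<^sup>+x. liminf (\<lambda>n. ennreal (exp (s n * x) * g x)) \<partial>lborel)"
    by (intro nn_integral_cong lim_imp_Liminf[symmetric] tendsto_ennrealI pt) auto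
  also have "\<dots> \<le> liminf (\<lambda>n. \<integral>\<^sup>+x. ennreal (exp (s n * x) * g x) \<partial>lborel)"
    by (rule nn_integral_liminf) measurable
  also have "(\<lambda>n. \<integral>\<^sup>+x. ennreal (exp (s n * x) * g x) \<partial>lborel) = (\<lambda>n. ennreal (m (s n)))"
    unfolding m_def using g_nonneg s by (intro ext nn_integral_eq_integral mgf_int) auto
  also have "liminf (\<lambda>n. ennreal (m (s n))) = ennreal (exp (\<Lambda> lp))"
    by (intro lim_imp_Liminf tendsto_ennrealI m_lim) auto
  finally have h_int: "integrable lborel h"
    using h_nonneg borel_measurable_continuous_onI[OF h_cont] by (intro integrableI_nonneg) (auto simp: top.extremum_unique less_top[symmetric])
  have "(\<lambda>n. \<integral>x. exp (s n * x) * g x \<partial>lborel) \<longlonglongrightarrow> (\<integral>x. h x \<partial>lborel)"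
  proof (rule integral_dominated_convergence)
    show "integrable lborel (\<lambda>x. g x + h x)" using g_int h_int by simp
    show "AE x in lborel. (\<lambda>n. exp (s n * x) * g x) \<longlonglongrightarrow> h x" using pt by simp
    fix n
    have "exp (s n * x) \<le> 1 + exp (lp * x)" for x
      using s[of n] by (intro exp_mult_le_add) auto
    then have "exp (s n * x) * g x \<le> (1 + exp (lp * x)) * g x" for x
      using g_nonneg by (intro mult_right_mono) auto
    then show "AE x in lborel. norm (exp (s n * x) * g x) \<le> g x + h x"
      using g_nonneg by (simp add: h_def distrib_right)
  qed (use h_int in auto)
  then have "(\<lambda>n. m (s n)) \<longlonglongrightarrow> (\<integral>x. h x \<partial>lborel)" by (simp add: m_def)
  then show ?thesis
    using h_int LIMSEQ_unique[OF m_lim] by (simp add: has_bochner_integral_iff)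
qed

text \<open>Multiplication by \<open>exp (lp * x)\<close> cancels the decay of the positive kernel
  exactly and raises the rate of the negative one to \<open>lm + lp\<close>; reflecting
  \<open>y\<close> brings the latter into the form of \<open>renewal_tail\<close>.\<close>

lemma AE_h_renewal:
  "AE x in lborel.
      integrable lborel (\<lambda>y. indicator {0<..} y * (h (x - y) * y powr - \<beta>p)) \<and>
      x * h x = \<alpha>p * (\<integral>y. indicator {0<..} y * (h (x - y) * y powr - \<beta>p) \<partial>lborel)
        - \<alpha>m * (\<integral>y. indicator {0<..} y * (h (x + y) * (y powr - \<beta>m * exp (- ((lm + lp) * y)))) \<partial>lborel)"
  using AE_xg_split AE_g_kernel_int(1)
proof eventually_elim
  case (elim x)
  have 1: "exp (lp * x) * (g (x - y) * gamma_kernel (1 - \<beta>p) lp y) = indicator {0<..} y * (h (x - y) * y powr - \<beta>p)" for y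
    by (simp add: h_def gamma_kernel_def algebra_simps flip: exp_add)
  have 2: "exp (lp * x) * (g (x - (- y)) * gamma_kernel (1 - \<beta>m) lm (- (- y))) =
      indicator {0<..} y * (h (x + y) * (y powr - \<beta>m * exp (- ((lm + lp) * y))))" for y
    by (simp add: h_def gamma_kernel_def algebra_simps flip: exp_add)
  have "integrable lborel (\<lambda>y. exp (lp * x) * (g (x - y) * gamma_kernel (1 - \<beta>p) lp y))"
    using elim by simp
  moreover have "x * h x = exp (lp * x) * (x * g x)"
    by (simp add: h_def)
  then have "x * h x = \<alpha>p * (\<integral>y. exp (lp * x) * (g (x - y) * gamma_kernel (1 - \<beta>p) lp y) \<partial>lborel)
      - \<alpha>m * (\<integral>y. exp (lp * x) * (g (x - y) * gamma_kernel (1 - \<beta>m) lm (- y)) \<partial>lborel)"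
    unfolding elim(1) by (simp add: algebra_simps)
  moreover have "(\<integral>y. exp (lp * x) * (g (x - y) * gamma_kernel (1 - \<beta>m) lm (- y)) \<partial>lborel)
     = (\<integral>y. exp (lp * x) * (g (x - (- y)) * gamma_kernel (1 - \<beta>m) lm (- (- y))) \<partial>lborel)"
    using lborel_integral_real_affine[of "-1" "\<lambda>y. exp (lp * x) * (g (x - y) * gamma_kernel (1 - \<beta>m) lm (- y))" 0] by simp
  ultimately show ?case unfolding 1 2 by simp
qed

lemma density_tail: "((\<lambda>x. x powr (1 + \<beta>p) * h x) \<longlongrightarrow> \<alpha>p * exp (\<Lambda> lp)) at_top"
proof -
  interpret renewal_tail h \<alpha>p \<alpha>m "lm + lp" \<beta>p \<beta>m "\<integral>x. h x \<partial>lborel"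
    "\<lambda>x. \<integral>y. indicator {0<..} y * (h (x - y) * y powr - \<beta>p) \<partial>lborel"
    "\<lambda>x. \<integral>y. indicator {0<..} y * (h (x + y) * (y powr - \<beta>m * exp (- ((lm + lp) * y)))) \<partial>lborel"
    using h_integral h_cont h_nonneg \<alpha>p \<alpha>m lp lm \<beta>p \<beta>m AE_h_renewal
    by unfold_locales (auto simp: has_bochner_integral_iff elim: AE_mp)
  show ?thesis
    using tail_limit h_integral by (simp add: has_bochner_integral_iff)
qed

end

theorem theorem7p10:
  fixes \<alpha>p \<beta>p lp \<alpha>m \<beta>m lm C :: real and \<eta> :: "real measure" and g :: "real \<Rightarrow> real"
  assumes "\<alpha>p > 0" and "lp > 0" and "\<alpha>m > 0" and "lm > 0"
    and "0 < \<beta>p" and "\<beta>p < 1" and "0 < \<beta>m" and "\<beta>m < 1"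
    and "tempered_stable \<alpha>p \<beta>p lp \<alpha>m \<beta>m lm \<eta>"
    and "continuous_on UNIV g" and "\<And>x. g x \<ge> 0"
    and "\<eta> = density lborel (\<lambda>x. ennreal (g x))"
    and "C = \<alpha>p * exp (- \<alpha>p * Gamma (- \<beta>p) * lp powr \<beta>p
               + \<alpha>m * Gamma (- \<beta>m) * ((lp + lm) powr \<beta>m - lm powr \<beta>m))"
  shows "C > 0 \<and> g \<sim>[at_top] (\<lambda>x. C * (exp (- lp * x) / x powr (1 + \<beta>p)))"
proof
  interpret tempered_stable_law \<alpha>p \<beta>p lp \<alpha>m \<beta>m lm \<eta> g
    using assms by unfold_locales
  show C: "C > 0" using assms by simp
  \<comment> \<open>At \<open>s = lp\<close> the term \<open>(lp - s) powr \<beta>p\<close> is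
    \<open>0 powr \<beta>p = 0\<close>, which leaves \<open>- lp powr \<beta>p\<close> in the first
    bracket.\<close>
  have "C = \<alpha>p * exp (\<Lambda> lp)"
    unfolding assms(13) \<Lambda>_def by (simp add: add.commute)
  with density_tail have "((\<lambda>x. x powr (1 + \<beta>p) * h x / C) \<longlongrightarrow> C / C) at_top"
    by (intro tendsto_divide tendsto_const) (use C in auto)
  moreover have "x powr (1 + \<beta>p) * h x / C = g x / (C * (exp (- lp * x) / x powr (1 + \<beta>p)))" for x
    by (simp add: h_def exp_minus field_simps)
  ultimately show "g \<sim>[at_top] (\<lambda>x. C * (exp (- lp * x) / x powr (1 + \<beta>p)))"
    using C by (intro asymp_equivI') simp
qed

end
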